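(* Let $0<s<1$. For $t\in\mathbb{R}$ and $z\in\mathbb{C}$ put $$B_s(t,z)=\left(\frac{1-s^2}{2\pi s\sqrt{s\pi}}\right)^{1/2}\exp\left(-\frac{1}{2s}t^2-\frac{1}{2s}z^2+\frac{\sqrt{1-s^2}}{s}\,tz\right),$$ and for $f\in L^2(\mathbb{R})$ put $[\mathscr{B}_sf](z)=\int_{\mathbb{R}}B_s(t,z)f(t)\,dt$, $z\in\mathbb{C}$. Then $\mathscr{B}_s$ is a unitary (isometric and surjective) linear map from $L^2(\mathbb{R})$ onto $\mathcal{X}_s(\mathbb{C})$.
   Context: $L^2(\mathbb{R})$ is taken with respect to Lebesgue measure $dt$. $d\lambda$ is Lebesgue measure on $\mathbb{C}\equiv\mathbb{R}^2$. For $0<s<1$ let $$\omega_s(z)=\exp\left(\frac{1+s^2}{4s}(z^2+\overline{z}^2)-\frac{1-s^2}{2s}|z|^2\right).$$ $\mathcal{X}_s(\mathbb{C})$ is the Hilbert space of all entire functions $F:\mathbb{C}\to\mathbb{C}$ with $\int_{\mathbb{C}}|F(z)|^2\omega_s(z)\,d\lambda(z)<\infty$, with the inner product of $L^2(\mathbb{C},\omega_s\,d\lambda)$. *)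

theory Defs
  imports "HOL-Complex_Analysis.Complex_Analysis"
begin

text \<open>
  Elements of \<open>L2 M\<close> are representatives: two of them denote the same vector of
  the Hilbert space iff they agree almost everywhere with respect to \<open>M\<close>.
\<close>

definition L2 :: "'a measure \<Rightarrow> ('a \<Rightarrow> complex) set" where
  "L2 M = {f \<in> borel_measurable M. integrable M (\<lambda>x. (cmod (f x))\<^sup>2)}"

definition L2_inner :: "'a measure \<Rightarrow> ('a \<Rightarrow> complex) \<Rightarrow> ('a \<Rightarrow> complex) \<Rightarrow> complex" where
  "L2_inner M f g = (\<integral>x. f x * cnj (g x) \<partial>M)"

definition L2_norm :: "'a measure \<Rightarrow> ('a \<Rightarrow> complex) \<Rightarrow> real" where
  "L2_norm M f = sqrt (\<integral>x. (cmod (f x))\<^sup>2 \<partial>M)"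

text \<open>\<open>z\<^sup>2 + cnj z\<^sup>2\<close> is real, so \<open>Re\<close> is only a coercion here.\<close>

definition omega :: "real \<Rightarrow> complex \<Rightarrow> real" where
  "omega s z = exp ((1 + s\<^sup>2) / (4 * s) * Re (z\<^sup>2 + (cnj z)\<^sup>2)
                    - (1 - s\<^sup>2) / (2 * s) * (cmod z)\<^sup>2)"

definition omega_measure :: "real \<Rightarrow> complex measure" where
  "omega_measure s = density lebesgue (\<lambda>z. ennreal (omega s z))"

text \<open>The inner product and norm of \<open>X_space s\<close> are those of \<open>L2 (omega_measure s)\<close>.\<close>

definition X_space :: "real \<Rightarrow> (complex \<Rightarrow> complex) set" where
  "X_space s = {F. F holomorphic_on UNIV \<and> F \<in> L2 (omega_measure s)}"

definition B_kernel :: "real \<Rightarrow> real \<Rightarrow> complex \<Rightarrow> complex" where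
  "B_kernel s t z =
     complex_of_real (sqrt ((1 - s\<^sup>2) / (2 * pi * s * sqrt (s * pi)))) *
     exp (- complex_of_real (1 / (2 * s)) * (complex_of_real t)\<^sup>2
          - complex_of_real (1 / (2 * s)) * z\<^sup>2
          + complex_of_real (sqrt (1 - s\<^sup>2) / s) * complex_of_real t * z)"

definition B_transform :: "real \<Rightarrow> (real \<Rightarrow> complex) \<Rightarrow> complex \<Rightarrow> complex" where
  "B_transform s f z = (\<integral>t. B_kernel s t z * f t \<partial>lebesgue)"

end

theory Submission
  imports Defs "HOL-Probability.Levy"
begin

text \<open>
  Multiplication by \<open>exp ((1 + s\<^sup>2) / (4 * s) * z\<^sup>2)\<close> turns \<open>omega\<close> into the radial weight
  \<open>exp (- \<beta> * |z|\<^sup>2)\<close> with \<open>\<beta> = (1 - s\<^sup>2) / (2 * s)\<close>, so \<open>X_space\<close> becomes a Fock space, and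
  \<open>B_kernel\<close> becomes a generating function \<open>\<Sum>n. h\<^sub>n t * z ^ n\<close> of (unnormalised) Hermite functions.
  The \<open>h\<^sub>n\<close> are orthogonal, because the Gaussian integral of two generating functions at \<open>x\<close>
  and \<open>y\<close> is a power series in \<open>x * y\<close>, and they are total, because the Fourier transform is
  injective on integrable functions. The monomials are orthogonal and total in the Fock space by
  averaging over rotations. The norms of \<open>h\<^sub>n\<close> and \<open>z ^ n\<close> match, so Parseval's identity gives the isometry
  and the Riesz-Fischer theorem the surjectivity.
\<close>

section \<open>Square-integrable functions\<close>

text \<open>The constants are tuned to one another. Moving the Gaussian factor into the kernel
  changes the coefficient of z^2 from -1/(2s) to -bet/2, and \<open>kap\<close>^2 = 2 s
  \<open>bet\<close> makes the squares cancel in the Gaussian inner product of two generating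
  functions, which leaves sqrt(pi s) exp(bet x y). So the squared norm of the n-th Hermite function
  is sqrt(pi s) bet^n / n!, while that of z^n is pi n! / bet^(n+1). Their product pi sqrt(pi s) /
  bet does not depend on n, and its reciprocal is the square of the constant in
  \<open>B_kernel\<close>. Explicit values (orthogonality, moments) come from comparing coefficients
  of power series, and agreement at small positive reals suffices for that. Norms over the plane are
  computed as integrals in [0, \<infinity>], before square integrability is known. The same formula
  then puts transforms into \<open>X_space\<close> and makes the Taylor coefficients of a given
  element of \<open>X_space\<close> summable with the right weights.\<close>

lemma L2_measurable: "f \<in> L2 M \<Longrightarrow> f \<in> borel_measurable M"
  by (simp add: L2_def)

lemma L2_integrable: "f \<in> L2 M \<Longrightarrow> integrable M (\<lambda>x. (cmod (f x))\<^sup>2)"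
  by (simp add: L2_def)

lemma L2_iff_nn_integral:
  "f \<in> L2 M \<longleftrightarrow> f \<in> borel_measurable M \<and> (\<integral>\<^sup>+x. ennreal ((cmod (f x))\<^sup>2) \<partial>M) < \<infinity>"
  by (auto simp: L2_def integrable_iff_bounded)

lemma L2_nn_integral:
  "f \<in> L2 M \<Longrightarrow> (\<integral>\<^sup>+x. ennreal ((cmod (f x))\<^sup>2) \<partial>M) = ennreal (\<integral>x. (cmod (f x))\<^sup>2 \<partial>M)"
  by (simp add: L2_def nn_integral_eq_integral)

lemma L2_mult_integrable:
  assumes "f \<in> L2 M" "g \<in> L2 M"
  shows "integrable M (\<lambda>x. f x * g x)"
proof (rule Bochner_Integration.integrable_bound)
  show "integrable M (\<lambda>x. (cmod (f x))\<^sup>2 + (cmod (g x))\<^sup>2)"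
    using assms by (simp add: L2_def)
  show "(\<lambda>x. f x * g x) \<in> borel_measurable M"
    using assms by (intro borel_measurable_times) (auto simp: L2_def)
  have "a * b \<le> a\<^sup>2 + b\<^sup>2" for a b :: real
    using sum_squares_bound[of a b] sum_power2_ge_zero[of a b] by linarith
  then show "AE x in M. norm (f x * g x) \<le> norm ((cmod (f x))\<^sup>2 + (cmod (g x))\<^sup>2)"
    by (simp add: norm_mult)
qed

lemma borel_measurable_cnj:
  "f \<in> borel_measurable M \<Longrightarrow> (\<lambda>x. cnj (f x)) \<in> borel_measurable M"
  by (rule borel_measurable_continuous_on[OF continuous_on_cnj[OF continuous_on_id]])

lemma L2_cnj: "f \<in> L2 M \<Longrightarrow> (\<lambda>x. cnj (f x)) \<in> L2 M"
  by (auto simp: L2_def intro: borel_measurable_cnj)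

lemma L2_scale: "f \<in> L2 M \<Longrightarrow> (\<lambda>x. a * f x) \<in> L2 M"
  by (auto simp: L2_def norm_mult power_mult_distrib)

lemma L2_add:
  assumes "f \<in> L2 M" "g \<in> L2 M"
  shows "(\<lambda>x. f x + g x) \<in> L2 M"
proof -
  have "integrable M (\<lambda>x. (cmod (f x + g x))\<^sup>2)"
  proof (rule Bochner_Integration.integrable_bound)
    show "integrable M (\<lambda>x. 2 * (cmod (f x))\<^sup>2 + 2 * (cmod (g x))\<^sup>2)"
      using assms by (simp add: L2_def)
    show "(\<lambda>x. (cmod (f x + g x))\<^sup>2) \<in> borel_measurable M"
      using assms by (intro borel_measurable_power borel_measurable_norm borel_measurable_add)
        (auto simp: L2_def)
    have "(cmod (a + b))\<^sup>2 \<le> 2 * (cmod a)\<^sup>2 + 2 * (cmod b)\<^sup>2" for a b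
    proof -
      have "(cmod (a + b))\<^sup>2 \<le> (cmod a + cmod b)\<^sup>2"
        by (simp add: norm_triangle_ineq power_mono)
      also have "\<dots> \<le> 2 * (cmod a)\<^sup>2 + 2 * (cmod b)\<^sup>2"
        using sum_squares_bound[of "cmod a" "cmod b"] by (simp add: power2_sum)
      finally show ?thesis .
    qed
    then show "AE x in M. norm ((cmod (f x + g x))\<^sup>2) \<le> norm (2 * (cmod (f x))\<^sup>2 + 2 * (cmod (g x))\<^sup>2)"
      by simp
  qed
  then show ?thesis using assms by (auto simp: L2_def intro: borel_measurable_add)
qed

lemma L2_lincomb: "f \<in> L2 M \<Longrightarrow> g \<in> L2 M \<Longrightarrow> (\<lambda>x. a * f x + b * g x) \<in> L2 M"
  by (intro L2_add L2_scale)

lemma L2_diff: "f \<in> L2 M \<Longrightarrow> g \<in> L2 M \<Longrightarrow> (\<lambda>x. f x - g x) \<in> L2 M"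
  using L2_lincomb[of f M g 1 "-1"] by simp

lemma L2_zero: "(\<lambda>x. 0) \<in> L2 M"
  by (simp add: L2_def)

lemma L2_sum: "(\<And>i. i \<in> A \<Longrightarrow> f i \<in> L2 M) \<Longrightarrow> (\<lambda>x. \<Sum>i\<in>A. f i x) \<in> L2 M"
  by (induction A rule: infinite_finite_induct) (auto intro: L2_add L2_zero)

lemma L2_inner_integrable:
  "f \<in> L2 M \<Longrightarrow> g \<in> L2 M \<Longrightarrow> integrable M (\<lambda>x. f x * cnj (g x))"
  by (intro L2_mult_integrable L2_cnj)

lemma L2_inner_lincomb_left:
  assumes "f \<in> L2 M" "g \<in> L2 M" "h \<in> L2 M"
  shows "L2_inner M (\<lambda>x. a * f x + b * g x) h = a * L2_inner M f h + b * L2_inner M g h"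
  using L2_inner_integrable[OF assms(1,3)] L2_inner_integrable[OF assms(2,3)]
  by (simp add: L2_inner_def distrib_right mult.assoc)

lemma L2_inner_sum_left:
  assumes "\<And>i. i \<in> A \<Longrightarrow> f i \<in> L2 M" "h \<in> L2 M"
  shows "L2_inner M (\<lambda>x. \<Sum>i\<in>A. f i x) h = (\<Sum>i\<in>A. L2_inner M (f i) h)"
  using L2_inner_integrable[OF assms(1) assms(2)]
  by (simp add: L2_inner_def sum_distrib_right)

lemma L2_inner_self: "L2_inner M f f = of_real (\<integral>x. (cmod (f x))\<^sup>2 \<partial>M)"
  unfolding L2_inner_def integral_complex_of_real[symmetric] complex_norm_square ..

text \<open>The variable coefficient serves two purposes: subtracting one term of an orthogonal
  expansion at a time, and recovering the inner product from norms by polarization.\<close>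

lemma L2_norm_lincomb:
  assumes "f \<in> L2 M" "g \<in> L2 M"
  shows "(\<integral>x. (cmod (f x + a * g x))\<^sup>2 \<partial>M)
    = (\<integral>x. (cmod (f x))\<^sup>2 \<partial>M) + 2 * Re (cnj a * L2_inner M f g) + (cmod a)\<^sup>2 * (\<integral>x. (cmod (g x))\<^sup>2 \<partial>M)"
proof -
  have *: "(cmod (u + a * v))\<^sup>2 = (cmod u)\<^sup>2 + 2 * Re (cnj a * (u * cnj v)) + (cmod a)\<^sup>2 * (cmod v)\<^sup>2" for u v
    by (simp only: cmod_power2) (simp add: power2_eq_square algebra_simps)
  have i: "integrable M (\<lambda>x. cnj a * (f x * cnj (g x)))"
    using L2_inner_integrable[OF assms] by simp
  have "(\<integral>x. Re (cnj a * (f x * cnj (g x))) \<partial>M) = Re (cnj a * L2_inner M f g)"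
    by (subst integral_Re[OF i]) (simp add: L2_inner_def)
  moreover have "integrable M (\<lambda>x. Re (cnj a * (f x * cnj (g x))))"
    using i by (rule integrable_Re)
  ultimately show ?thesis
    unfolding * using assms L2_integrable[OF assms(1)] L2_integrable[OF assms(2)]
    by (simp del: times_complex.sel cnj.sel complex_cnj_mult)
qed

lemma L2_Cauchy_Schwarz:
  assumes "f \<in> L2 M" "g \<in> L2 M"
  shows "(cmod (\<integral>x. f x * g x \<partial>M))\<^sup>2 \<le> (\<integral>x. (cmod (f x))\<^sup>2 \<partial>M) * (\<integral>x. (cmod (g x))\<^sup>2 \<partial>M)"
proof -
  have [measurable]: "f \<in> borel_measurable M" "g \<in> borel_measurable M"
    using assms by (auto simp: L2_def)
  have "ennreal ((cmod (\<integral>x. f x * g x \<partial>M))\<^sup>2) \<le> (\<integral>\<^sup>+x. ennreal (cmod (f x * g x)) \<partial>M)\<^sup>2"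
    using integral_norm_bound_ennreal[OF L2_mult_integrable[OF assms]]
    by (simp add: ennreal_power[symmetric] power_mono)
  also have "\<dots> = (\<integral>\<^sup>+x. ennreal (cmod (f x)) * ennreal (cmod (g x)) \<partial>M)\<^sup>2"
    by (simp add: norm_mult ennreal_mult)
  also have "\<dots> \<le> (\<integral>\<^sup>+x. (ennreal (cmod (f x)))\<^sup>2 \<partial>M) * (\<integral>\<^sup>+x. (ennreal (cmod (g x)))\<^sup>2 \<partial>M)"
    by (rule Cauchy_Schwarz_nn_integral) auto
  also have "\<dots> = ennreal ((\<integral>x. (cmod (f x))\<^sup>2 \<partial>M) * (\<integral>x. (cmod (g x))\<^sup>2 \<partial>M))"
    using assms by (simp add: ennreal_power L2_nn_integral ennreal_mult)
  finally show ?thesis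
    by (simp add: ennreal_le_iff)
qed

section \<open>Continuity of the pairing and completeness of L2\<close>

lemma L2_integral_tendsto:
  assumes "\<And>n. S n \<in> L2 M" "g \<in> L2 M" "h \<in> L2 M"
    and "(\<lambda>n::nat. \<integral>x. (cmod (g x - S n x))\<^sup>2 \<partial>M) \<longlonglongrightarrow> 0"
  shows "(\<lambda>n. \<integral>x. S n x * h x \<partial>M) \<longlonglongrightarrow> (\<integral>x. g x * h x \<partial>M)"
proof -
  define D where "D = (\<lambda>n. (\<integral>x. g x * h x \<partial>M) - (\<integral>x. S n x * h x \<partial>M))"
  have D: "D n = (\<integral>x. (g x - S n x) * h x \<partial>M)" for n
    using L2_mult_integrable[OF assms(1,3)] L2_mult_integrable[OF assms(2,3)]
    by (simp add: D_def left_diff_distrib)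
  have "(\<lambda>n. (cmod (D n))\<^sup>2) \<longlonglongrightarrow> 0"
  proof (rule tendsto_sandwich[OF _ _ tendsto_const])
    show "\<forall>\<^sub>F n in sequentially. (cmod (D n))\<^sup>2
        \<le> (\<integral>x. (cmod (g x - S n x))\<^sup>2 \<partial>M) * (\<integral>x. (cmod (h x))\<^sup>2 \<partial>M)"
      unfolding D by (intro always_eventually allI L2_Cauchy_Schwarz L2_diff assms)
    show "(\<lambda>n. (\<integral>x. (cmod (g x - S n x))\<^sup>2 \<partial>M) * (\<integral>x. (cmod (h x))\<^sup>2 \<partial>M)) \<longlonglongrightarrow> 0"
      using tendsto_mult_right[OF assms(4)] by simp
  qed auto
  then have "(\<lambda>n. sqrt ((cmod (D n))\<^sup>2)) \<longlonglongrightarrow> sqrt 0"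
    by (rule tendsto_real_sqrt)
  then have "D \<longlonglongrightarrow> 0"
    by (simp add: tendsto_norm_zero_iff)
  from tendsto_diff[OF tendsto_const this, of "\<integral>x. g x * h x \<partial>M"] show ?thesis
    by (simp add: D_def)
qed

text \<open>A rapidly converging subsequence has square increments with integral below 4^-k.
  Weighted by 2^k they still have a finite total integral, so the subsequence converges almost
  everywhere; Fatou's lemma then carries the Cauchy estimates over to the pointwise limit.\<close>

lemma L2_complete:
  assumes S: "\<And>n. S n \<in> L2 M"
    and Cauchy: "\<And>e. e > 0 \<Longrightarrow> \<exists>N::nat. \<forall>m\<ge>N. \<forall>n\<ge>N. (\<integral>x. (cmod (S m x - S n x))\<^sup>2 \<partial>M) < e"
  obtains g where "g \<in> L2 M" "(\<lambda>n. \<integral>x. (cmod (g x - S n x))\<^sup>2 \<partial>M) \<longlonglongrightarrow> 0"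
proof -
  have [measurable]: "S n \<in> borel_measurable M" for n
    using S by (rule L2_measurable)
  have "\<exists>N. \<forall>m\<ge>N. \<forall>n\<ge>N. (\<integral>x. (cmod (S m x - S n x))\<^sup>2 \<partial>M) < (1/4)^k" for k
    by (rule Cauchy) simp
  then obtain N where N: "\<And>k m n. m \<ge> N k \<Longrightarrow> n \<ge> N k \<Longrightarrow> (\<integral>x. (cmod (S m x - S n x))\<^sup>2 \<partial>M) < (1/4)^k"
    by metis
  \<comment> \<open>The sum makes both \<open>R k\<close> and \<open>R (Suc k)\<close> at least
    \<open>N k\<close>, although \<open>N\<close> need not be monotone. The summand \<open>k\<close>
    makes \<open>R\<close> tend to infinity.\<close>
  define R where "R k = k + (\<Sum>j\<le>k. N j)" for k
  have R: "R k \<ge> k" "R k \<ge> N k" "R (Suc k) \<ge> N k" for k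
    using member_le_sum[of k "{..k}" N] by (auto simp: R_def)
  define d where "d k x = S (R (Suc k)) x - S (R k) x" for k x
  have d_L2: "d k \<in> L2 M" for k
    unfolding d_def[abs_def] by (intro L2_diff S)
  have [measurable]: "d k \<in> borel_measurable M" for k
    using d_L2 by (rule L2_measurable)
  have "(\<integral>\<^sup>+x. (\<Sum>k. ennreal (2^k * (cmod (d k x))\<^sup>2)) \<partial>M) = (\<Sum>k. \<integral>\<^sup>+x. ennreal (2^k * (cmod (d k x))\<^sup>2) \<partial>M)"
    by (rule nn_integral_suminf) simp
  also have "\<dots> \<le> (\<Sum>k. ennreal ((1/2)^k))"
  proof (rule suminf_le)
    fix k
    have "(\<integral>\<^sup>+x. ennreal (2^k * (cmod (d k x))\<^sup>2) \<partial>M) = ennreal (2^k * (\<integral>x. (cmod (d k x))\<^sup>2 \<partial>M))"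
      using L2_integrable[OF d_L2] by (subst nn_integral_eq_integral) auto
    also have "\<dots> \<le> ennreal (2^k * (1/4)^k)"
      using N[OF R(3) R(2), of k] by (intro ennreal_leI mult_left_mono) (auto simp: d_def)
    also have "2^k * (1/4)^k = (1/2::real)^k"
      by (simp flip: power_mult_distrib)
    finally show "(\<integral>\<^sup>+x. ennreal (2^k * (cmod (d k x))\<^sup>2) \<partial>M) \<le> ennreal ((1/2)^k)" .
  qed auto
  also have "\<dots> = ennreal (\<Sum>k. (1/2)^k)"
    by (rule suminf_ennreal2) (auto simp: summable_geometric)
  finally have fin: "(\<integral>\<^sup>+x. (\<Sum>k. ennreal (2^k * (cmod (d k x))\<^sup>2)) \<partial>M) < \<infinity>"
    by (rule order.strict_trans1) simp
  have "AE x in M. (\<Sum>k. ennreal (2^k * (cmod (d k x))\<^sup>2)) \<noteq> \<infinity>"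
    by (rule nn_integral_noteq_infinite) (use fin in auto)
  then have conv: "AE x in M. convergent (\<lambda>k. S (R k) x)"
  proof eventually_elim
    case (elim x)
    then have sm: "summable (\<lambda>k. 2^k * (cmod (d k x))\<^sup>2)"
      by (intro summable_suminf_not_top) auto
    have "summable (\<lambda>k. cmod (d k x))"
    proof (rule summable_comparison_test')
      show "summable (\<lambda>k. (1/2)^k + 2^k * (cmod (d k x))\<^sup>2)"
        by (intro summable_add sm) (auto simp: summable_geometric)
      fix k
      \<comment> \<open>This yields c \<le> 2^-k + 2^k c^2 for c = \<open>cmod (d k x)\<close>:
        summability of the weighted squares gives absolute summability of the increments
        themselves.\<close>
      define u where "u = 2^k * cmod (d k x)"
      have "u \<le> 1 + u\<^sup>2"
        using sum_squares_bound[of u 1] zero_le_power2[of u] by (simp; linarith)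
      then have "(1/2)^k * u \<le> (1/2)^k * (1 + u\<^sup>2)"
        by (intro mult_left_mono) auto
      then show "norm (cmod (d k x)) \<le> (1/2)^k + 2^k * (cmod (d k x))\<^sup>2"
        by (simp add: u_def field_simps power2_eq_square)
    qed
    then have "summable (\<lambda>k. d k x)"
      by (rule summable_norm_cancel)
    then have "convergent (\<lambda>n. \<Sum>k<n. d k x)"
      by (simp add: summable_iff_convergent)
    then have "convergent (\<lambda>n. S (R n) x - S (R 0) x)"
      unfolding d_def by (simp add: sum_lessThan_telescope[of "\<lambda>k. S (R k) x"])
    then show ?case
      using convergent_diff_const_right_iff by blast
  qed
  define g where "g x = lim (\<lambda>k. S (R k) x)" for x
  have g_meas[measurable]: "g \<in> borel_measurable M"
    unfolding g_def[abs_def] by measurable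
  \<comment> \<open>Used twice: with bound 1 to place \<open>g\<close> in L2, and with an
    arbitrarily small bound to get convergence in norm.\<close>
  have Fatou: "(\<integral>\<^sup>+x. ennreal ((cmod (g x - S n x))\<^sup>2) \<partial>M) \<le> ennreal e"
    if K: "\<And>m. m \<ge> K \<Longrightarrow> (\<integral>x. (cmod (S m x - S n x))\<^sup>2 \<partial>M) \<le> e" for n e K
  proof -
    have "(\<integral>\<^sup>+x. ennreal ((cmod (g x - S n x))\<^sup>2) \<partial>M)
        = (\<integral>\<^sup>+x. liminf (\<lambda>k. ennreal ((cmod (S (R k) x - S n x))\<^sup>2)) \<partial>M)"
    proof (rule nn_integral_cong_AE)
      show "AE x in M. ennreal ((cmod (g x - S n x))\<^sup>2) = liminf (\<lambda>k. ennreal ((cmod (S (R k) x - S n x))\<^sup>2))"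
        using conv
      proof eventually_elim
        case (elim x)
        then have "(\<lambda>k. S (R k) x) \<longlonglongrightarrow> g x"
          by (simp add: g_def convergent_LIMSEQ_iff)
        then have "(\<lambda>k. ennreal ((cmod (S (R k) x - S n x))\<^sup>2)) \<longlonglongrightarrow> ennreal ((cmod (g x - S n x))\<^sup>2)"
          by (intro tendsto_intros)
        then show ?case
          by (intro lim_imp_Liminf[symmetric]) auto
      qed
    qed
    also have "\<dots> \<le> liminf (\<lambda>k. \<integral>\<^sup>+x. ennreal ((cmod (S (R k) x - S n x))\<^sup>2) \<partial>M)"
      by (rule nn_integral_liminf) simp
    also have "\<dots> \<le> limsup (\<lambda>k. \<integral>\<^sup>+x. ennreal ((cmod (S (R k) x - S n x))\<^sup>2) \<partial>M)"
      by (rule Liminf_le_Limsup) simp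
    also have "\<dots> \<le> ennreal e"
    proof (rule Limsup_bounded)
      show "\<forall>\<^sub>F k in sequentially. (\<integral>\<^sup>+x. ennreal ((cmod (S (R k) x - S n x))\<^sup>2) \<partial>M) \<le> ennreal e"
        using eventually_ge_at_top[of K]
      proof eventually_elim
        case (elim k)
        with R(1)[of k] have "R k \<ge> K" by simp
        then show ?case
          using K[of "R k"] by (simp add: L2_nn_integral[OF L2_diff[OF S S]] ennreal_leI)
      qed
    qed
    finally show ?thesis .
  qed
  obtain K where K: "\<And>m n. m \<ge> K \<Longrightarrow> n \<ge> K \<Longrightarrow> (\<integral>x. (cmod (S m x - S n x))\<^sup>2 \<partial>M) < 1"
    using Cauchy[of 1] by auto
  have "(\<lambda>x. g x - S K x) \<in> L2 M"
    using Fatou[of K K 1] K by (auto simp: L2_iff_nn_integral less_imp_le intro: le_less_trans)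
  from L2_add[OF this S[of K]] have gL2: "g \<in> L2 M"
    by simp
  have "(\<lambda>n. \<integral>x. (cmod (g x - S n x))\<^sup>2 \<partial>M) \<longlonglongrightarrow> 0"
  proof (rule LIMSEQ_I)
    fix e :: real assume "e > 0"
    \<comment> \<open>Half of \<open>e\<close>, because \<open>Fatou\<close> returns only a weak
      inequality.\<close>
    then obtain K where K: "\<And>m n. m \<ge> K \<Longrightarrow> n \<ge> K \<Longrightarrow> (\<integral>x. (cmod (S m x - S n x))\<^sup>2 \<partial>M) < e / 2"
      using Cauchy[of "e/2"] by auto
    show "\<exists>K. \<forall>n\<ge>K. norm ((\<integral>x. (cmod (g x - S n x))\<^sup>2 \<partial>M) - 0) < e"
    proof (intro exI allI impI)
      fix n assume "n \<ge> K"
      then have "(\<integral>\<^sup>+x. ennreal ((cmod (g x - S n x))\<^sup>2) \<partial>M) \<le> ennreal (e/2)"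
        using K by (intro Fatou[of K]) (auto intro: less_imp_le)
      then show "norm ((\<integral>x. (cmod (g x - S n x))\<^sup>2 \<partial>M) - 0) < e"
        using \<open>e > 0\<close> by (simp add: L2_nn_integral[OF L2_diff[OF gL2 S]])
    qed
  qed
  with gL2 show ?thesis by (rule that)
qed

section \<open>Orthogonal systems: best approximation, Riesz-Fischer, Parseval\<close>

text \<open>Squared norms \<open>w\<close> are kept as data instead of being scaled to 1, so that
  Taylor coefficients of a generating function can be used as they stand. Totality is left to
  \<open>Parseval\<close>: the second instance, the characters of the circle with nonnegative
  frequency, is orthogonal but not total.\<close>

locale L2_orthogonal =
  fixes M :: "'a measure" and e :: "nat \<Rightarrow> 'a \<Rightarrow> complex" and w :: "nat \<Rightarrow> real"
  assumes e_L2: "e n \<in> L2 M"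
    and w_pos: "w n > 0"
    and orth: "L2_inner M (e m) (e n) = (if m = n then of_real (w n) else 0)"
begin

lemma norm_e: "(\<integral>x. (cmod (e n x))\<^sup>2 \<partial>M) = w n"
  using orth[of n n] by (simp add: L2_inner_self)

lemma lincomb_L2: "(\<lambda>x. \<Sum>k\<in>A. a k * e k x) \<in> L2 M"
  by (intro L2_sum L2_scale e_L2)

lemma inner_lincomb:
  assumes "finite A"
  shows "L2_inner M (\<lambda>x. \<Sum>k\<in>A. a k * e k x) (e n) = (if n \<in> A then a n * of_real (w n) else 0)"
proof -
  have "L2_inner M (\<lambda>x. \<Sum>k\<in>A. a k * e k x) (e n) = (\<Sum>k\<in>A. L2_inner M (\<lambda>x. a k * e k x) (e n))"
    by (intro L2_inner_sum_left L2_scale e_L2)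
  also have "\<dots> = (\<Sum>k\<in>A. if k = n then a k * of_real (w n) else 0)"
    using L2_inner_lincomb_left[OF e_L2 L2_zero e_L2, where b=0] by (intro sum.cong) (auto simp: orth)
  finally show ?thesis
    using assms by (simp add: sum.delta)
qed

text \<open>Removing the terms already treated does not change the inner product with a new
  \<open>e j\<close>, so each term contributes independently. The coefficients are arbitrary:
  \<open>f = 0\<close> gives Pythagoras, and Fourier coefficients of \<open>f\<close> give the
  remainder in Bessel's inequality.\<close>

lemma norm_diff_lincomb:
  assumes "f \<in> L2 M" "finite A"
  shows "(\<integral>x. (cmod (f x - (\<Sum>k\<in>A. a k * e k x)))\<^sup>2 \<partial>M)
    = (\<integral>x. (cmod (f x))\<^sup>2 \<partial>M) - 2 * (\<Sum>k\<in>A. Re (cnj (a k) * L2_inner M f (e k))) + (\<Sum>k\<in>A. (cmod (a k))\<^sup>2 * w k)"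
  using assms(2)
proof (induction A)
  case (insert j A)
  define u where "u x = f x - (\<Sum>k\<in>A. a k * e k x)" for x
  have u: "u \<in> L2 M"
    unfolding u_def[abs_def] by (intro L2_diff assms lincomb_L2)
  have "L2_inner M u (e j) = L2_inner M f (e j)"
    using L2_inner_lincomb_left[OF assms(1) lincomb_L2 e_L2, where a=1 and b="-1"] insert.hyps
    by (simp add: u_def[abs_def] inner_lincomb)
  then have "(\<integral>x. (cmod (u x + (- a j) * e j x))\<^sup>2 \<partial>M)
      = (\<integral>x. (cmod (u x))\<^sup>2 \<partial>M) - 2 * Re (cnj (a j) * L2_inner M f (e j)) + (cmod (a j))\<^sup>2 * w j"
    by (subst L2_norm_lincomb[OF u e_L2]) (simp add: norm_e)
  moreover have "u x + (- a j) * e j x = f x - (\<Sum>k\<in>insert j A. a k * e k x)" for x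
    using insert.hyps by (simp add: u_def)
  ultimately show ?case
    using insert by (simp add: u_def algebra_simps)
qed simp

lemma norm_lincomb:
  assumes "finite A"
  shows "(\<integral>x. (cmod (\<Sum>k\<in>A. a k * e k x))\<^sup>2 \<partial>M) = (\<Sum>k\<in>A. (cmod (a k))\<^sup>2 * w k)"
  using norm_diff_lincomb[OF L2_zero assms, of a] by (simp add: L2_inner_def)

text \<open>By Pythagoras the squared distance of two partial sums is a segment of the given
  convergent series, so completeness supplies the limit. Its inner product with \<open>e n\<close>
  is the limit of a sequence that is constant as soon as the n-th term is included.\<close>

lemma Riesz_Fischer:
  assumes "summable (\<lambda>n. (cmod (a n))\<^sup>2 * w n)"
  obtains g where "g \<in> L2 M"
    "(\<lambda>n. \<integral>x. (cmod (g x - (\<Sum>k<n. a k * e k x)))\<^sup>2 \<partial>M) \<longlonglongrightarrow> 0"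
    "\<And>n. L2_inner M g (e n) = a n * of_real (w n)"
proof -
  define S where "S n x = (\<Sum>k<n. a k * e k x)" for n x
  have S: "S n \<in> L2 M" for n
    unfolding S_def[abs_def] by (rule lincomb_L2)
  have tail: "(\<integral>x. (cmod (S m x - S n x))\<^sup>2 \<partial>M) < r"
    if r: "\<And>m n. m \<ge> N \<Longrightarrow> norm (\<Sum>k=m..<n. (cmod (a k))\<^sup>2 * w k) < r" and "n \<ge> N" "m \<ge> n" for r N m n
  proof -
    have "S m x - S n x = (\<Sum>k=n..<m. a k * e k x)" for x
      using sum_diff_nat_ivl[of 0 n m "\<lambda>k. a k * e k x"] \<open>m \<ge> n\<close> by (simp add: S_def lessThan_atLeast0)
    then show ?thesis
      using r[OF \<open>n \<ge> N\<close>, of m] by (simp add: norm_lincomb)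
  qed
  have "\<exists>N. \<forall>m\<ge>N. \<forall>n\<ge>N. (\<integral>x. (cmod (S m x - S n x))\<^sup>2 \<partial>M) < r" if "r > 0" for r
  proof -
    obtain N where N: "\<And>m n. m \<ge> N \<Longrightarrow> norm (\<Sum>k=m..<n. (cmod (a k))\<^sup>2 * w k) < r"
      using assms \<open>r > 0\<close> unfolding summable_Cauchy by blast
    have "(\<integral>x. (cmod (S m x - S n x))\<^sup>2 \<partial>M) < r" if "m \<ge> N" "n \<ge> N" for m n
    proof (cases "m \<ge> n")
      case True
      with N that show ?thesis by (intro tail)
    next
      case False
      with N that have "(\<integral>x. (cmod (S n x - S m x))\<^sup>2 \<partial>M) < r" by (intro tail) auto
      then show ?thesis by (simp add: norm_minus_commute)
    qed
    then show ?thesis by blast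
  qed
  with S obtain g where g: "g \<in> L2 M" "(\<lambda>n. \<integral>x. (cmod (g x - S n x))\<^sup>2 \<partial>M) \<longlonglongrightarrow> 0"
    by (rule L2_complete)
  have "L2_inner M g (e n) = a n * of_real (w n)" for n
  proof (rule LIMSEQ_unique)
    show "(\<lambda>N. L2_inner M (S N) (e n)) \<longlonglongrightarrow> L2_inner M g (e n)"
      unfolding L2_inner_def by (intro L2_integral_tendsto S g L2_cnj e_L2)
    have "\<forall>\<^sub>F N in sequentially. L2_inner M (S N) (e n) = a n * of_real (w n)"
      using eventually_gt_at_top[of n] by eventually_elim (simp add: S_def[abs_def] inner_lincomb)
    then show "(\<lambda>N. L2_inner M (S N) (e n)) \<longlonglongrightarrow> a n * of_real (w n)"
      by (rule tendsto_eventually)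
  qed
  with g show ?thesis
    unfolding S_def by (intro that)
qed

text \<open>Bessel's inequality lets \<open>Riesz_Fischer\<close> build a \<open>g\<close> with the
  same coefficients as \<open>f\<close>. Totality forces \<open>f = g\<close> almost everywhere, so
  the expansion converges to \<open>f\<close> itself and the Bessel remainder tends to 0.\<close>

lemma Parseval:
  assumes total: "\<And>h. h \<in> L2 M \<Longrightarrow> (\<And>n. L2_inner M h (e n) = 0) \<Longrightarrow> AE x in M. h x = 0"
    and f: "f \<in> L2 M"
  shows "(\<lambda>n. (cmod (L2_inner M f (e n)))\<^sup>2 / w n) sums (\<integral>x. (cmod (f x))\<^sup>2 \<partial>M)"
proof -
  define a where "a n = L2_inner M f (e n) / of_real (w n)" for n
  have a: "(cmod (a n))\<^sup>2 * w n = (cmod (L2_inner M f (e n)))\<^sup>2 / w n" for n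
    using w_pos[of n] by (simp add: a_def norm_divide power2_eq_square)
  have Re: "Re (cnj (a n) * L2_inner M f (e n)) = (cmod (a n))\<^sup>2 * w n" for n
  proof -
    have "L2_inner M f (e n) = a n * of_real (w n)"
      using w_pos[of n] by (simp add: a_def)
    then have "cnj (a n) * L2_inner M f (e n) = (a n * cnj (a n)) * of_real (w n)"
      by simp
    also have "\<dots> = of_real ((cmod (a n))\<^sup>2 * w n)"
      unfolding of_real_mult complex_norm_square ..
    finally show ?thesis by simp
  qed
  have rem: "(\<integral>x. (cmod (f x - (\<Sum>k<n. a k * e k x)))\<^sup>2 \<partial>M)
      = (\<integral>x. (cmod (f x))\<^sup>2 \<partial>M) - (\<Sum>k<n. (cmod (a k))\<^sup>2 * w k)" for n
    by (simp only: norm_diff_lincomb[OF f finite_lessThan] Re)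
  have "(\<Sum>k<n. (cmod (a k))\<^sup>2 * w k) \<le> (\<integral>x. (cmod (f x))\<^sup>2 \<partial>M)" for n
  proof -
    have "0 \<le> (\<integral>x. (cmod (f x - (\<Sum>k<n. a k * e k x)))\<^sup>2 \<partial>M)"
      by (rule Bochner_Integration.integral_nonneg) simp
    with rem[of n] show ?thesis by simp
  qed
  then have "summable (\<lambda>n. (cmod (a n))\<^sup>2 * w n)"
    by (intro summableI_nonneg_bounded mult_nonneg_nonneg less_imp_le[OF w_pos] zero_le_power2)
  then obtain g where g: "g \<in> L2 M"
    "(\<lambda>n. \<integral>x. (cmod (g x - (\<Sum>k<n. a k * e k x)))\<^sup>2 \<partial>M) \<longlonglongrightarrow> 0"
    "\<And>n. L2_inner M g (e n) = a n * of_real (w n)"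
    using Riesz_Fischer by blast
  have "AE x in M. f x - g x = 0"
  proof (rule total)
    fix n
    show "L2_inner M (\<lambda>x. f x - g x) (e n) = 0"
      using L2_inner_lincomb_left[OF f g(1) e_L2, where a=1 and b="-1"] w_pos[of n]
      by (simp add: g(3) a_def)
  qed (intro L2_diff f g)
  then have "(\<integral>x. (cmod (g x - (\<Sum>k<n. a k * e k x)))\<^sup>2 \<partial>M)
      = (\<integral>x. (cmod (f x - (\<Sum>k<n. a k * e k x)))\<^sup>2 \<partial>M)" for n
    using L2_measurable[OF L2_diff[OF f lincomb_L2, of a]] L2_measurable[OF L2_diff[OF g(1) lincomb_L2, of a]]
    by (intro integral_cong_AE) auto
  with g(2) have "(\<lambda>n. (\<integral>x. (cmod (f x))\<^sup>2 \<partial>M) - (\<Sum>k<n. (cmod (a k))\<^sup>2 * w k)) \<longlonglongrightarrow> 0"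
    by (simp add: rem)
  from tendsto_diff[OF tendsto_const this, of "\<integral>x. (cmod (f x))\<^sup>2 \<partial>M"] show ?thesis
    by (simp add: sums_def flip: a)
qed

end

section \<open>Power series and Gaussian integrals\<close>

text \<open>Zeros of a nonzero power series are isolated, so agreement at positive reals near 0 is
  enough. This is the tool by which inner products and moments are read off from closed
  forms.\<close>

lemma powser_coeffs_unique:
  fixes a b :: "nat \<Rightarrow> complex"
  assumes "r > 0"
    and a: "\<And>x::real. 0 < x \<Longrightarrow> x < r \<Longrightarrow> (\<lambda>n. a n * of_real x ^ n) sums F x"
    and b: "\<And>x::real. 0 < x \<Longrightarrow> x < r \<Longrightarrow> (\<lambda>n. b n * of_real x ^ n) sums F x"
  shows "a = b"
proof (rule ccontr)
  assume "a \<noteq> b"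
  then obtain m where m: "a m - b m \<noteq> 0"
    by (auto simp: fun_eq_iff)
  \<comment> \<open>The difference series is multiplied by z so that it vanishes at 0, as
    \<open>powser_0_nonzero\<close> requires. This shifts the nonzero coefficient from
    \<open>m\<close> to \<open>Suc m\<close>.\<close>
  define c where "c n = (if n = 0 then 0 else a (n - 1) - b (n - 1))" for n
  define f where "f z = (\<Sum>n. c n * z ^ n)" for z
  have ab0: "(\<lambda>n. (a n - b n) * of_real x ^ n) sums 0" if "0 < x" "x < r" for x
    using sums_diff[OF a[OF that] b[OF that]] by (simp add: algebra_simps)
  have c0: "(\<lambda>n. c n * of_real x ^ n) sums 0" if "0 < x" "x < r" for x
  proof -
    have "(\<lambda>n. c (Suc n) * of_real x ^ Suc n) sums 0"
      using sums_mult2[OF ab0[OF that], of "of_real x"] by (simp add: c_def mult_ac)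
    then show ?thesis
      by (subst (asm) sums_Suc_iff) (simp add: c_def)
  qed
  have sm: "(\<lambda>n. c n * (z - 0) ^ n) sums f z" if "norm (z - 0) < r/2" for z
    using powser_inside[of c "of_real (r/2)" z] c0[of "r/2"] that \<open>r > 0\<close>
    unfolding f_def by (auto simp: sums_iff intro: summable_sums)
  have "f 0 = 0"
    by (simp add: f_def c_def powser_zero)
  moreover have "c (Suc m) \<noteq> 0"
    using m by (simp add: c_def)
  ultimately obtain e where e: "0 < e" "\<And>z. z \<in> cball 0 e - {0} \<Longrightarrow> f z \<noteq> 0"
    using powser_0_nonzero[of "r/2" 0 c f "Suc m"] sm \<open>r > 0\<close> by auto
  define x where "x = min e (r/4)"
  have "0 < x" "x < r" "x \<le> e"
    using \<open>r > 0\<close> \<open>0 < e\<close> by (auto simp: x_def)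
  with c0[of x] have "f (of_real x) = 0"
    by (simp add: f_def sums_iff)
  with e(2)[of "of_real x"] \<open>0 < x\<close> \<open>x \<le> e\<close> show False
    by auto
qed

lemma exp_powser_sums:
  fixes c z :: "'a::{real_normed_field,banach}"
  shows "(\<lambda>n. c ^ n / fact n * z ^ n) sums exp (c * z)"
proof -
  have "(c * z) ^ n /\<^sub>R fact n = c ^ n / fact n * z ^ n" for n
    by (simp add: scaleR_conv_of_real power_mult_distrib field_simps)
  with exp_converges[of "c * z"] show ?thesis by simp
qed

lemma sums_even:
  fixes f :: "nat \<Rightarrow> 'a::real_normed_vector"
  assumes "f sums x"
  shows "(\<lambda>n. if even n then f (n div 2) else 0) sums x"
proof -
  have "strict_mono (\<lambda>n::nat. 2 * n)"
    by (simp add: strict_mono_def)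
  then have "(\<lambda>n. (\<lambda>n. if even n then f (n div 2) else 0) (2 * n)) sums x
      \<longleftrightarrow> (\<lambda>n. if even n then f (n div 2) else 0) sums x"
    by (rule sums_mono_reindex) (auto elim: evenE)
  with assms show ?thesis by simp
qed

text \<open>Completing the square turns the integrand into a multiple of the normal density with
  mean b/(2a) and standard deviation 1/sqrt(2a).\<close>

lemma has_bochner_integral_gaussian:
  fixes a b :: real
  assumes "a > 0"
  shows "has_bochner_integral lborel (\<lambda>t. exp (- a * t\<^sup>2 + b * t)) (sqrt (pi / a) * exp (b\<^sup>2 / (4 * a)))"
proof -
  have "exp (- a * t\<^sup>2 + b * t)
      = sqrt (pi / a) * exp (b\<^sup>2 / (4 * a)) * normal_density (b / (2 * a)) (1 / sqrt (2 * a)) t" for t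
  proof -
    have "- (t - b / (2 * a))\<^sup>2 / (2 * (1 / sqrt (2 * a))\<^sup>2) = - a * t\<^sup>2 + b * t - b\<^sup>2 / (4 * a)"
      using assms by (simp add: power_divide field_simps power2_eq_square)
    moreover have "sqrt (2 * pi * (1 / sqrt (2 * a))\<^sup>2) = sqrt (pi / a)"
      using assms by (simp add: power_divide)
    ultimately show ?thesis
      unfolding normal_density_def
      using assms by (simp only:) (simp add: exp_add[symmetric] mult.assoc exp_diff field_simps)
  qed
  moreover have "has_bochner_integral lborel (normal_density (b / (2 * a)) (1 / sqrt (2 * a))) 1"
    using assms by (simp add: has_bochner_integral_iff)
  ultimately show ?thesis
    using has_bochner_integral_mult_right[of "sqrt (pi / a) * exp (b\<^sup>2 / (4 * a))"] by fastforce
qed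

lemma integrable_gaussian_abs:
  fixes a b :: real
  assumes "a > 0"
  shows "integrable lborel (\<lambda>t. exp (- a * t\<^sup>2 + b * \<bar>t\<bar>))"
proof (rule Bochner_Integration.integrable_bound)
  show "integrable lborel (\<lambda>t. exp (- a * t\<^sup>2 + b * t) + exp (- a * t\<^sup>2 + (- b) * t))"
    using has_bochner_integral_gaussian[OF assms]
    by (intro Bochner_Integration.integrable_add) (auto simp only: has_bochner_integral_iff)
  show "(\<lambda>t. exp (- a * t\<^sup>2 + b * \<bar>t\<bar>)) \<in> borel_measurable lborel"
    by measurable
  have "exp (- a * t\<^sup>2 + b * \<bar>t\<bar>) \<le> exp (- a * t\<^sup>2 + b * t) + exp (- a * t\<^sup>2 + (- b) * t)" for t
    by (cases "t \<ge> 0") auto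
  then show "AE t in lborel. norm (exp (- a * t\<^sup>2 + b * \<bar>t\<bar>)) \<le> norm (exp (- a * t\<^sup>2 + b * t) + exp (- a * t\<^sup>2 + (- b) * t))"
    by (intro always_eventually allI) (simp only: real_norm_def abs_of_pos add_pos_pos exp_gt_zero)
qed

lemma L2_dominated:
  assumes "g \<in> L2 M" "f \<in> borel_measurable M" "\<And>x. cmod (f x) \<le> cmod (g x)"
  shows "f \<in> L2 M"
proof -
  have "integrable M (\<lambda>x. (cmod (f x))\<^sup>2)"
  proof (rule Bochner_Integration.integrable_bound[OF L2_integrable[OF assms(1)]])
    show "(\<lambda>x. (cmod (f x))\<^sup>2) \<in> borel_measurable M"
      using assms(2) by measurable
    show "AE x in M. norm ((cmod (f x))\<^sup>2) \<le> norm ((cmod (g x))\<^sup>2)"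
      using assms(3) by (simp add: power_mono)
  qed
  with assms(2) show ?thesis by (simp add: L2_def)
qed

lemma lebesgue_measurableI: "f \<in> borel_measurable borel \<Longrightarrow> f \<in> borel_measurable lebesgue"
  by (simp add: measurable_completion)

section \<open>Hermite functions\<close>

locale bargmann =
  fixes s :: real
  assumes s_pos: "0 < s" and s_less_1: "s < 1"
begin

definition kap :: real where "kap = sqrt (1 - s\<^sup>2)"
definition bet :: real where "bet = (1 - s\<^sup>2) / (2 * s)"

lemma kap_pos: "kap > 0" and bet_pos: "bet > 0"
  and kap_bet: "kap\<^sup>2 = 2 * s * bet"
proof -
  have "s\<^sup>2 < 1"
    using s_pos s_less_1 by (simp add: power_less_one_iff)
  then have "kap\<^sup>2 = 1 - s\<^sup>2" and pos: "kap > 0" "bet > 0"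
    using s_pos by (auto simp: kap_def bet_def)
  then show "kap\<^sup>2 = 2 * s * bet"
    using s_pos by (simp add: bet_def)
  show "kap > 0" "bet > 0"
    by (fact pos)+
qed

text \<open>\<open>gker\<close> is the kernel after multiplication by the Gaussian factor, without its constant;
  \<open>gdom r\<close> dominates the absolute power series of \<open>gker\<close> on the disc of radius \<open>r\<close>, and
  \<open>gcoeff\<close> are the Taylor coefficients of \<open>exp (- bet / 2 * z\<^sup>2)\<close>.\<close>

definition gker :: "real \<Rightarrow> complex \<Rightarrow> complex" where
  "gker t z = exp (- of_real (t\<^sup>2 / (2 * s)) + of_real (kap * t / s) * z - of_real (bet / 2) * z\<^sup>2)"

definition gdom :: "real \<Rightarrow> real \<Rightarrow> real" where
  "gdom r t = exp (- (t\<^sup>2 / (2 * s)) + kap * r / s * \<bar>t\<bar> + bet / 2 * r\<^sup>2)"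

definition gcoeff :: "nat \<Rightarrow> real" where
  "gcoeff n = (if even n then (- bet / 2) ^ (n div 2) / fact (n div 2) else 0)"

text \<open>The coefficient of z^n in \<open>gker t z\<close>, written as a Cauchy product of the
  linear and the quadratic exponential. In classical terms it is (bet/2)^(n/2) / n! times
  exp(-t^2/(2s)) H_n(t/sqrt s), with H_n the physicists' Hermite polynomial.\<close>

definition herm :: "nat \<Rightarrow> real \<Rightarrow> real" where
  "herm n t = exp (- (t\<^sup>2 / (2 * s))) * (\<Sum>k\<le>n. (kap * t / s) ^ k / fact k * gcoeff (n - k))"

lemma gcoeff_sums: "(\<lambda>n. of_real (gcoeff n) * z ^ n) sums exp (- of_real (bet / 2) * z\<^sup>2)"
  for z :: complex
proof -
  have "(\<lambda>n. of_real ((- bet / 2) ^ n / fact n) * (z\<^sup>2) ^ n) sums exp (- of_real (bet / 2) * z\<^sup>2)"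
    using exp_powser_sums[of "- of_real (bet / 2)" "z\<^sup>2"] by simp
  note sums_even[OF this]
  moreover have "(if even n then of_real ((- bet / 2) ^ (n div 2) / fact (n div 2)) * (z\<^sup>2) ^ (n div 2) else 0)
      = of_real (gcoeff n) * z ^ n" for n
    by (auto simp: gcoeff_def power_mult[symmetric])
  ultimately show ?thesis by simp
qed

lemma gcoeff_abs_sums: "(\<lambda>n. \<bar>gcoeff n\<bar> * r ^ n) sums exp (bet / 2 * r\<^sup>2)" for r :: real
proof -
  have "(\<lambda>n. (bet / 2) ^ n / fact n * (r\<^sup>2) ^ n) sums exp (bet / 2 * r\<^sup>2)"
    by (rule exp_powser_sums)
  note sums_even[OF this]
  moreover have "(if even n then (bet / 2) ^ (n div 2) / fact (n div 2) * (r\<^sup>2) ^ (n div 2) else 0)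
      = \<bar>gcoeff n\<bar> * r ^ n" for n
    using bet_pos by (auto simp: gcoeff_def power_mult[symmetric] power_abs)
  ultimately show ?thesis by simp
qed

lemma herm_sums: "(\<lambda>n. of_real (herm n t) * z ^ n) sums gker t z"
proof -
  define a where "a k = of_real ((kap * t / s) ^ k / fact k) * z ^ k" for k
  define b where "b k = of_real (gcoeff k) * z ^ k" for k
  have a: "a sums exp (of_real (kap * t / s) * z)"
    using exp_powser_sums[of "of_real (kap * t / s)" z] by (simp add: a_def[abs_def])
  have b: "b sums exp (- of_real (bet / 2) * z\<^sup>2)"
    unfolding b_def by (rule gcoeff_sums)
  have "summable (\<lambda>k. norm (a k))"
    using exp_powser_sums[of "\<bar>kap * t / s\<bar>" "cmod z"]
    by (simp add: a_def norm_mult norm_divide norm_power sums_iff abs_mult)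
  moreover have "summable (\<lambda>k. norm (b k))"
    using gcoeff_abs_sums[of "cmod z"] by (simp add: b_def norm_mult norm_power sums_iff)
  ultimately have "(\<lambda>k. \<Sum>i\<le>k. a i * b (k - i)) sums (exp (of_real (kap * t / s) * z) * exp (- of_real (bet / 2) * z\<^sup>2))"
    using Cauchy_product_sums[of a b] a b by (simp add: sums_iff)
  from sums_mult[OF this, of "exp (- of_real (t\<^sup>2 / (2 * s)))"]
  have *: "(\<lambda>k. exp (- of_real (t\<^sup>2 / (2 * s))) * (\<Sum>i\<le>k. a i * b (k - i))) sums gker t z"
    by (simp add: gker_def algebra_simps flip: exp_add)
  have "exp (- of_real (t\<^sup>2 / (2 * s))) * (\<Sum>i\<le>k. a i * b (k - i)) = of_real (herm k t) * z ^ k" for k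
  proof -
    have "(\<Sum>i\<le>k. a i * b (k - i)) = (\<Sum>i\<le>k. of_real ((kap * t / s) ^ i / fact i * gcoeff (k - i)) * z ^ k)"
    proof (intro sum.cong refl)
      fix i assume "i \<in> {..k}"
      then have "z ^ k = z ^ i * z ^ (k - i)"
        by (simp flip: power_add)
      then show "a i * b (k - i) = of_real ((kap * t / s) ^ i / fact i * gcoeff (k - i)) * z ^ k"
        by (simp add: a_def b_def)
    qed
    also have "\<dots> = of_real (\<Sum>i\<le>k. (kap * t / s) ^ i / fact i * gcoeff (k - i)) * z ^ k"
      unfolding of_real_sum sum_distrib_right ..
    finally show ?thesis
      unfolding herm_def of_real_mult exp_of_real[symmetric] of_real_minus by (simp only: mult.assoc)
  qed
  with * show ?thesis by simp
qed

text \<open>Taking absolute values in both factors of the Cauchy product removes the alternating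
  signs of \<open>gcoeff\<close>, hence the plus sign before bet/2 in \<open>gdom\<close>. The bound
  is uniform in \<open>N\<close> and square integrable in \<open>t\<close>, which is what the
  interchange of sum and integral calls for.\<close>

lemma herm_abs_le:
  assumes "r \<ge> 0"
  shows "(\<Sum>n<N. \<bar>herm n t\<bar> * r ^ n) \<le> gdom r t"
proof -
  define a where "a k = (kap * \<bar>t\<bar> / s) ^ k / fact k * r ^ k" for k
  define b where "b k = \<bar>gcoeff k\<bar> * r ^ k" for k
  have nn: "a k \<ge> 0" "b k \<ge> 0" for k
    using assms kap_pos s_pos by (auto simp: a_def b_def)
  have a: "a sums exp (kap * \<bar>t\<bar> / s * r)"
    unfolding a_def by (rule exp_powser_sums)
  have b: "b sums exp (bet / 2 * r\<^sup>2)"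
    unfolding b_def by (rule gcoeff_abs_sums)
  have "(\<lambda>k. \<Sum>i\<le>k. a i * b (k - i)) sums (exp (kap * \<bar>t\<bar> / s * r) * exp (bet / 2 * r\<^sup>2))"
    using Cauchy_product_sums[of a b] a b nn by (simp add: sums_iff)
  from sums_mult[OF this, of "exp (- (t\<^sup>2 / (2 * s)))"]
  have *: "(\<lambda>k. exp (- (t\<^sup>2 / (2 * s))) * (\<Sum>i\<le>k. a i * b (k - i))) sums gdom r t"
    by (simp add: gdom_def exp_add[symmetric] algebra_simps)
  have le: "\<bar>herm k t\<bar> * r ^ k \<le> exp (- (t\<^sup>2 / (2 * s))) * (\<Sum>i\<le>k. a i * b (k - i))" for k
  proof -
    have "\<bar>\<Sum>i\<le>k. (kap * t / s) ^ i / fact i * gcoeff (k - i)\<bar> * r ^ k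
        \<le> (\<Sum>i\<le>k. \<bar>(kap * t / s) ^ i / fact i * gcoeff (k - i)\<bar>) * r ^ k"
      using assms by (intro mult_right_mono sum_abs) auto
    also have "\<dots> = (\<Sum>i\<le>k. a i * b (k - i))"
      unfolding sum_distrib_right
    proof (intro sum.cong refl)
      fix i assume "i \<in> {..k}"
      then have "r ^ k = r ^ i * r ^ (k - i)"
        by (simp flip: power_add)
      then show "\<bar>(kap * t / s) ^ i / fact i * gcoeff (k - i)\<bar> * r ^ k = a i * b (k - i)"
        using kap_pos s_pos
        by (simp add: a_def b_def abs_mult power_abs power_mult_distrib)
    qed
    finally show ?thesis
      by (simp add: herm_def abs_mult mult.assoc)
  qed
  have "(\<Sum>n<N. \<bar>herm n t\<bar> * r ^ n) \<le> (\<Sum>n<N. exp (- (t\<^sup>2 / (2 * s))) * (\<Sum>i\<le>n. a i * b (n - i)))"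
    by (intro sum_mono le)
  also have "\<dots> \<le> gdom r t"
    using * nn by (intro sum_le_suminf[THEN order_trans]) (auto simp: sums_iff intro!: sum_nonneg mult_nonneg_nonneg)
  finally show ?thesis .
qed

lemma herm_abs_summable: "r \<ge> 0 \<Longrightarrow> summable (\<lambda>n. \<bar>herm n t\<bar> * r ^ n)"
  by (rule summableI_nonneg_bounded[where x="gdom r t"]) (auto intro: herm_abs_le)

lemma borel_measurable_gdom [measurable]: "gdom r \<in> borel_measurable borel"
  unfolding gdom_def[abs_def] by measurable

lemma borel_measurable_herm [measurable]: "herm n \<in> borel_measurable borel"
  unfolding herm_def[abs_def] by measurable

lemma borel_measurable_gker [measurable]: "(\<lambda>t. gker t z) \<in> borel_measurable borel"
  unfolding gker_def[abs_def] by (intro borel_measurable_continuous_onI continuous_intros) (use s_pos in auto)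

lemma gdom_L2: "(\<lambda>t. complex_of_real (gdom r t)) \<in> L2 lebesgue"
proof -
  have "(\<lambda>t. (cmod (complex_of_real (gdom r t)))\<^sup>2)
      = (\<lambda>t. exp (bet * r\<^sup>2) * exp (- (1/s) * t\<^sup>2 + 2 * (kap * r / s) * \<bar>t\<bar>))"
    by (auto simp: gdom_def power2_eq_square exp_add[symmetric] field_simps)
  moreover have "integrable lborel (\<lambda>t. exp (bet * r\<^sup>2) * exp (- (1/s) * t\<^sup>2 + 2 * (kap * r / s) * \<bar>t\<bar>))"
    using s_pos by (intro integrable_mult_right integrable_gaussian_abs) auto
  ultimately have "integrable lebesgue (\<lambda>t. (cmod (complex_of_real (gdom r t)))\<^sup>2)"
    by (subst integrable_completion) auto
  then show ?thesis
    unfolding L2_def by (auto intro!: lebesgue_measurableI)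
qed

lemma herm_L2: "(\<lambda>t. complex_of_real (herm n t)) \<in> L2 lebesgue"
proof (rule L2_dominated[OF gdom_L2[of 1]])
  fix t
  have "\<bar>herm n t\<bar> \<le> (\<Sum>n<Suc n. \<bar>herm n t\<bar> * 1 ^ n)"
    by (simp add: sum_nonneg)
  also have "\<dots> \<le> gdom 1 t"
    by (rule herm_abs_le) simp
  finally show "cmod (complex_of_real (herm n t)) \<le> cmod (complex_of_real (gdom 1 t))"
    by simp
qed (auto intro!: lebesgue_measurableI)

lemma norm_gker_le: "cmod (gker t z) \<le> gdom (cmod z) t"
proof -
  have "cmod (\<Sum>n<N. of_real (herm n t) * z ^ n) \<le> gdom (cmod z) t" for N
    by (rule order_trans[OF norm_sum]) (use herm_abs_le[of "cmod z" t N] in \<open>simp add: norm_mult norm_power\<close>)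
  moreover have "(\<lambda>N. cmod (\<Sum>n<N. of_real (herm n t) * z ^ n)) \<longlonglongrightarrow> cmod (gker t z)"
    using herm_sums[of t z] unfolding sums_def by (rule tendsto_norm)
  ultimately show ?thesis
    by (intro LIMSEQ_le_const2) auto
qed

lemma gker_L2: "(\<lambda>t. gker t z) \<in> L2 lebesgue"
proof (rule L2_dominated[OF gdom_L2[of "cmod z"]])
  show "cmod (gker t z) \<le> cmod (complex_of_real (gdom (cmod z) t))" for t
    using norm_gker_le[of t z] by simp
qed (auto intro!: lebesgue_measurableI)

text \<open>The norms of the terms add up to at most \<open>gdom (cmod z) t * cmod (f t)\<close>, a
  product of two L2 functions, so sum and integral may be interchanged. Choosing \<open>f\<close> as
  a generating function, a Hermite function or an arbitrary vector yields in turn the orthogonality,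
  the totality and the Taylor series of the transform.\<close>

lemma gker_transform_sums:
  assumes f: "f \<in> L2 lebesgue"
  shows "(\<lambda>n. (\<integral>t. of_real (herm n t) * f t \<partial>lebesgue) * z ^ n) sums (\<integral>t. gker t z * f t \<partial>lebesgue)"
proof -
  define F where "F n t = (of_real (herm n t) * f t) * z ^ n" for n t
  have Fint: "integrable lebesgue (F n)" for n
    unfolding F_def[abs_def] by (intro integrable_mult_left L2_mult_integrable herm_L2 f)
  have nF: "norm (F n t) = \<bar>herm n t\<bar> * (cmod z) ^ n * cmod (f t)" for n t
    by (simp add: F_def norm_mult norm_power)
  have "(\<lambda>n. integral\<^sup>L lebesgue (F n)) sums (\<integral>t. (\<Sum>n. F n t) \<partial>lebesgue)"
  proof (rule sums_integral[OF Fint])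
    show "AE t in lebesgue. summable (\<lambda>n. norm (F n t))"
      unfolding nF by (intro always_eventually allI summable_mult2 herm_abs_summable) auto
    show "summable (\<lambda>n. \<integral>t. norm (F n t) \<partial>lebesgue)"
    proof (rule summableI_nonneg_bounded)
      fix N
      have "(\<Sum>n<N. \<integral>t. norm (F n t) \<partial>lebesgue) = (\<integral>t. (\<Sum>n<N. norm (F n t)) \<partial>lebesgue)"
        by (rule Bochner_Integration.integral_sum[symmetric]) (use Fint in auto)
      also have "\<dots> \<le> (\<integral>t. norm (of_real (gdom (cmod z) t) * f t) \<partial>lebesgue)"
      proof (rule integral_mono)
        show "integrable lebesgue (\<lambda>t. \<Sum>n<N. norm (F n t))"
          using Fint by auto
        show "integrable lebesgue (\<lambda>t. norm (of_real (gdom (cmod z) t) * f t))"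
          by (intro integrable_norm L2_mult_integrable gdom_L2 f)
        fix t
        have "gdom (cmod z) t \<ge> 0" by (simp add: gdom_def)
        then show "(\<Sum>n<N. norm (F n t)) \<le> norm (of_real (gdom (cmod z) t) * f t)"
          unfolding nF sum_distrib_right[symmetric] norm_mult
          by (intro mult_mono) (auto intro: herm_abs_le)
      qed
      finally show "(\<Sum>n<N. \<integral>t. norm (F n t) \<partial>lebesgue) \<le> (\<integral>t. norm (of_real (gdom (cmod z) t) * f t) \<partial>lebesgue)" .
    qed auto
  qed
  moreover have "(\<Sum>n. F n t) = gker t z * f t" for t
    using sums_mult2[OF herm_sums[of t z], of "f t"] by (simp add: F_def sums_iff mult.assoc mult.left_commute mult.commute)
  ultimately show ?thesis
    by (simp add: F_def[abs_def])
qed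

section \<open>Orthogonality of the Hermite functions\<close>

lemma gker_real_inner:
  "(\<integral>t. gker t (of_real x) * gker t (of_real y) \<partial>lebesgue) = of_real (sqrt (pi * s) * exp (bet * x * y))"
proof -
  define b where "b = kap * (x + y) / s"
  have e: "- (t\<^sup>2 / s) + b * t - bet / 2 * (x\<^sup>2 + y\<^sup>2) = (- (t\<^sup>2 / (2 * s)) + kap * t / s * x - bet / 2 * x\<^sup>2)
       + (- (t\<^sup>2 / (2 * s)) + kap * t / s * y - bet / 2 * y\<^sup>2)" for t
    using s_pos by (simp add: b_def field_simps)
  have "gker t (of_real x) * gker t (of_real y)
      = of_real (exp (- bet / 2 * (x\<^sup>2 + y\<^sup>2)) * exp (- (1/s) * t\<^sup>2 + b * t))" for t
  proof -
    have "gker t (of_real x) * gker t (of_real y) = of_real (exp (- (t\<^sup>2 / s) + b * t - bet / 2 * (x\<^sup>2 + y\<^sup>2)))"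
      unfolding e exp_add of_real_mult by (simp add: gker_def exp_of_real[symmetric])
    also have "exp (- (t\<^sup>2 / s) + b * t - bet / 2 * (x\<^sup>2 + y\<^sup>2)) = exp (- bet / 2 * (x\<^sup>2 + y\<^sup>2)) * exp (- (1/s) * t\<^sup>2 + b * t)"
      by (simp add: exp_add[symmetric])
    finally show ?thesis .
  qed
  then have "(\<integral>t. gker t (of_real x) * gker t (of_real y) \<partial>lebesgue)
      = of_real (exp (- bet / 2 * (x\<^sup>2 + y\<^sup>2)) * (\<integral>t. exp (- (1/s) * t\<^sup>2 + b * t) \<partial>lborel))"
    by (simp only: integral_complex_of_real) (simp add: integral_completion)
  also have "(\<integral>t. exp (- (1/s) * t\<^sup>2 + b * t) \<partial>lborel) = sqrt (pi * s) * exp (b\<^sup>2 / (4 * (1/s)))"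
    using has_bochner_integral_gaussian[of "1/s" b] s_pos by (simp add: has_bochner_integral_iff)
  \<comment> \<open>Here \<open>kap_bet\<close> enters: the exponent becomes bet/2 (x + y)^2, and
    after subtracting bet/2 (x^2 + y^2) only the mixed term bet x y survives.\<close>
  also have "b\<^sup>2 / (4 * (1/s)) = bet / 2 * (x + y)\<^sup>2"
    using s_pos kap_bet by (simp add: b_def power_mult_distrib power_divide field_simps power2_eq_square)
  also have "exp (- bet / 2 * (x\<^sup>2 + y\<^sup>2)) * (sqrt (pi * s) * exp (bet / 2 * (x + y)\<^sup>2)) = sqrt (pi * s) * exp (bet * x * y)"
    by (simp add: exp_add[symmetric] mult.left_commute power2_sum algebra_simps)
  finally show ?thesis .
qed

text \<open>The coefficient of (x y)^n in sqrt(pi s) exp(bet x y), the inner product of two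
  generating functions.\<close>

definition hnorm :: "nat \<Rightarrow> real" where
  "hnorm n = sqrt (pi * s) * bet ^ n / fact n"

lemma hnorm_pos: "hnorm n > 0"
  using s_pos bet_pos by (simp add: hnorm_def)

text \<open>With \<open>y\<close> fixed, coefficients of x^n are compared in the inner product of
  the generating functions at \<open>x\<close> and \<open>y\<close>.\<close>

lemma herm_gker_inner:
  "(\<integral>t. of_real (herm n t) * gker t (of_real y) \<partial>lebesgue) = of_real (hnorm n) * of_real y ^ n"
proof -
  define F where "F x = complex_of_real (sqrt (pi * s) * exp (bet * x * y))" for x
  have "(\<lambda>n. \<integral>t. of_real (herm n t) * gker t (of_real y) \<partial>lebesgue) = (\<lambda>n. of_real (hnorm n) * of_real y ^ n)"
  proof (rule powser_coeffs_unique[of 1])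
    fix x :: real
    show "(\<lambda>n. (\<integral>t. of_real (herm n t) * gker t (of_real y) \<partial>lebesgue) * of_real x ^ n) sums F x"
      using gker_transform_sums[OF gker_L2[of "of_real y"], of "of_real x"] by (simp add: gker_real_inner F_def)
    have "(\<lambda>n. sqrt (pi * s) * ((bet * x * y) ^ n /\<^sub>R fact n)) sums (sqrt (pi * s) * exp (bet * x * y))"
      by (intro sums_mult exp_converges)
    then have "(\<lambda>n. complex_of_real (sqrt (pi * s) * ((bet * x * y) ^ n /\<^sub>R fact n))) sums F x"
      unfolding F_def by (rule sums_of_real)
    moreover have "complex_of_real (sqrt (pi * s) * ((bet * x * y) ^ n /\<^sub>R fact n)) = of_real (hnorm n) * of_real y ^ n * of_real x ^ n" for n
      by (simp add: hnorm_def power_mult_distrib divide_inverse)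
    ultimately show "(\<lambda>n. of_real (hnorm n) * of_real y ^ n * of_real x ^ n) sums F x"
      by simp
  qed simp
  then show ?thesis by meson
qed

text \<open>A second comparison, now in the remaining variable: the series with coefficients
  \<langle>h_m, h_n\<rangle> sums to the single monomial \<open>hnorm n * x ^ n\<close>.\<close>

lemma herm_orthogonal:
  "(\<integral>t. complex_of_real (herm m t) * of_real (herm n t) \<partial>lebesgue) = (if m = n then of_real (hnorm n) else 0)"
proof -
  define F where "F x = of_real (hnorm n) * complex_of_real x ^ n" for x :: real
  have "(\<lambda>m. \<integral>t. complex_of_real (herm m t) * of_real (herm n t) \<partial>lebesgue) = (\<lambda>m. if m = n then of_real (hnorm n) else 0)"
  proof (rule powser_coeffs_unique[of 1])
    fix x :: real
    show "(\<lambda>m. (\<integral>t. complex_of_real (herm m t) * of_real (herm n t) \<partial>lebesgue) * of_real x ^ m) sums F x"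
      using gker_transform_sums[OF herm_L2[of n], of "of_real x"] herm_gker_inner[of n x]
      by (simp add: F_def mult.commute)
    have "(if m = n then complex_of_real (hnorm n) else 0) * of_real x ^ m
        = (if m = n then of_real (hnorm n) * of_real x ^ m else 0)" for m
      by simp
    then show "(\<lambda>m. (if m = n then complex_of_real (hnorm n) else 0) * of_real x ^ m) sums F x"
      using sums_single[of n "\<lambda>m. of_real (hnorm n) * complex_of_real x ^ m"] by (simp only: F_def)
  qed simp
  then show ?thesis by meson
qed

sublocale hermite: L2_orthogonal lebesgue "\<lambda>n t. complex_of_real (herm n t)" hnorm
  by unfold_locales (auto simp: herm_L2 hnorm_pos L2_inner_def herm_orthogonal)

end

section \<open>Injectivity of the Fourier transform\<close>

lemma real_distribution_normalized_density:
  fixes p :: "real \<Rightarrow> real"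
  assumes p: "integrable lborel p" "\<And>x. p x \<ge> 0" and c: "(\<integral>x. p x \<partial>lborel) = c" "c > 0"
  shows "real_distribution (density lborel (\<lambda>x. ennreal (p x / c)))"
proof -
  have "(\<integral>\<^sup>+x. ennreal (p x / c) \<partial>lborel) = 1"
    using p c by (subst nn_integral_eq_integral) auto
  then have "prob_space (density lborel (\<lambda>x. ennreal (p x / c)))"
    using borel_measurable_integrable[OF p(1)] by (intro prob_spaceI) (simp add: emeasure_density)
  then show ?thesis
    by (simp add: real_distribution_def real_distribution_axioms_def)
qed

text \<open>The positive and negative parts of \<open>g\<close> have equal Fourier transforms,
  hence, at frequency 0, equal mass \<open>c\<close>. If \<open>c\<close> is 0 both vanish almost
  everywhere; otherwise division by \<open>c\<close> gives two probability measures with one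
  characteristic function, and Levy's uniqueness theorem identifies their densities.\<close>

lemma Fourier_injective_lborel:
  fixes g :: "real \<Rightarrow> real"
  assumes g: "integrable lborel g" and ft: "\<And>y. (\<integral>t. iexp (y * t) * of_real (g t) \<partial>lborel) = 0"
  shows "AE t in lborel. g t = 0"
proof -
  have [measurable]: "g \<in> borel_measurable borel"
    using borel_measurable_integrable[OF g] by simp
  define p where "p t = max 0 (g t)" for t
  define n where "n t = max 0 (- g t)" for t
  have [measurable]: "p \<in> borel_measurable borel" "n \<in> borel_measurable borel"
    unfolding p_def[abs_def] n_def[abs_def] by measurable
  have pn: "g t = p t - n t" "p t \<ge> 0" "n t \<ge> 0" for t
    by (auto simp: p_def n_def)
  have p: "integrable lborel p" and n: "integrable lborel n"
    using g unfolding p_def[abs_def] n_def[abs_def] by auto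
  have iexp: "integrable lborel (\<lambda>t. iexp (y * t) * of_real (q t))" if q: "integrable lborel q" for q y
  proof (rule Bochner_Integration.integrable_bound[OF q])
    show "(\<lambda>t. iexp (y * t) * of_real (q t)) \<in> borel_measurable lborel"
      using borel_measurable_integrable[OF q] by measurable
  qed (simp add: norm_mult)
  have eq: "(\<integral>t. iexp (y * t) * of_real (p t) \<partial>lborel) = (\<integral>t. iexp (y * t) * of_real (n t) \<partial>lborel)" for y
    using ft[of y] iexp[OF p, of y] iexp[OF n, of y] by (simp add: pn(1) right_diff_distrib)
  define c where "c = (\<integral>t. p t \<partial>lborel)"
  have c: "c = (\<integral>t. n t \<partial>lborel)"
    using eq[of 0] by (simp add: c_def)
  show ?thesis
  proof (cases "c = 0")
    case True
    then have "AE t in lborel. p t = 0"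
      using integral_nonneg_eq_0_iff_AE[OF p] pn by (auto simp: c_def)
    moreover have "AE t in lborel. n t = 0"
      using True integral_nonneg_eq_0_iff_AE[OF n] pn by (auto simp: c)
    ultimately show ?thesis
      by eventually_elim (simp add: pn(1))
  next
    case False
    have "c \<ge> 0"
      unfolding c_def by (rule Bochner_Integration.integral_nonneg) (simp add: pn)
    with False have c_pos: "c > 0" by simp
    have ch: "char (density lborel (\<lambda>x. ennreal (q x / c))) y = (\<integral>t. iexp (y * t) * of_real (q t) \<partial>lborel) / of_real c"
      if [measurable]: "q \<in> borel_measurable borel" and "\<And>x. q x \<ge> 0" for q y
      unfolding char_def using that c_pos
      by (subst integral_density) (auto simp: scaleR_conv_of_real mult.commute simp flip: integral_divide_zero)
    have "density lborel (\<lambda>x. ennreal (p x / c)) = density lborel (\<lambda>x. ennreal (n x / c))"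
    proof (rule Levy_uniqueness)
      show "real_distribution (density lborel (\<lambda>x. ennreal (p x / c)))"
        by (rule real_distribution_normalized_density) (use p pn c_pos in \<open>auto simp: c_def\<close>)
      show "real_distribution (density lborel (\<lambda>x. ennreal (n x / c)))"
        by (rule real_distribution_normalized_density) (use n pn c_pos in \<open>auto simp: c\<close>)
      show "char (density lborel (\<lambda>x. ennreal (p x / c))) = char (density lborel (\<lambda>x. ennreal (n x / c)))"
        using eq pn by (intro ext) (simp add: ch)
    qed
    then have "AE x in lborel. ennreal (p x / c) = ennreal (n x / c)"
      by (intro sigma_finite_measure.density_unique[OF sigma_finite_lborel]) auto
    then show ?thesis
      by eventually_elim (use c_pos pn in auto)
  qed
qed

text \<open>A Lebesgue measurable function agrees almost everywhere with a Borel one, for which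
  integrals over \<open>lebesgue\<close> and \<open>lborel\<close> coincide.\<close>

lemma Fourier_injective_real:
  fixes g :: "real \<Rightarrow> real"
  assumes g: "integrable lebesgue g" and ft: "\<And>y. (\<integral>t. iexp (y * t) * of_real (g t) \<partial>lebesgue) = 0"
  shows "AE t in lebesgue. g t = 0"
proof -
  obtain g' where g'[measurable]: "g' \<in> borel_measurable lborel" and "AE t in lborel. g t = g' t"
    using completion_ex_borel_measurable_real[OF borel_measurable_integrable[OF g]] by auto
  then have ae: "AE t in lebesgue. g t = g' t"
    by (intro AE_completion)
  have m[measurable]: "g' \<in> borel_measurable lebesgue" "g \<in> borel_measurable lebesgue"
    using g' borel_measurable_integrable[OF g] by (auto intro: measurable_completion)
  have "AE t in lborel. g' t = 0"
  proof (rule Fourier_injective_lborel)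
    have "integrable lebesgue g'"
      using g m ae by (subst integrable_cong_AE[of _ _ g]) auto
    then show "integrable lborel g'"
      by (simp add: integrable_completion)
    fix y
    have b: "(\<lambda>t. iexp (y * t)) \<in> borel_measurable borel"
      by measurable
    then have b': "(\<lambda>t. iexp (y * t)) \<in> borel_measurable lebesgue"
      by (rule lebesgue_measurableI)
    have "(\<integral>t. iexp (y * t) * of_real (g' t) \<partial>lborel) = (\<integral>t. iexp (y * t) * of_real (g' t) \<partial>lebesgue)"
      using b by (intro integral_completion[symmetric] borel_measurable_times borel_measurable_of_real) auto
    also have "\<dots> = (\<integral>t. iexp (y * t) * of_real (g t) \<partial>lebesgue)"
      using m b' ae by (intro integral_cong_AE borel_measurable_times borel_measurable_of_real) auto
    finally show "(\<integral>t. iexp (y * t) * of_real (g' t) \<partial>lborel) = 0"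
      by (simp only: ft)
  qed
  then have "AE t in lebesgue. g' t = 0"
    by (rule AE_completion)
  with ae show ?thesis
    by eventually_elim simp
qed

text \<open>The transform of the conjugate at \<open>y\<close> is the conjugate of the transform at
  \<open>-y\<close>. So it vanishes too, and with it the transforms of the real and imaginary
  parts.\<close>

lemma Fourier_injective:
  fixes g :: "real \<Rightarrow> complex"
  assumes g: "integrable lebesgue g" and ft: "\<And>y. (\<integral>t. iexp (y * t) * g t \<partial>lebesgue) = 0"
  shows "AE t in lebesgue. g t = 0"
proof -
  have int: "integrable lebesgue (\<lambda>t. iexp (y * t) * h t)" if h: "integrable lebesgue h" for h y
  proof (rule Bochner_Integration.integrable_bound[OF h])
    show "(\<lambda>t. iexp (y * t) * h t) \<in> borel_measurable lebesgue"
      by (rule borel_measurable_times[OF lebesgue_measurableI borel_measurable_integrable[OF h]]) measurable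
  qed (simp add: norm_mult)
  have gc: "integrable lebesgue (\<lambda>t. cnj (g t))"
    using g by simp
  have ftc: "(\<integral>t. iexp (y * t) * cnj (g t) \<partial>lebesgue) = 0" for y
  proof -
    have "iexp (y * t) * cnj (g t) = cnj (iexp ((- y) * t) * g t)" for t
      by (simp add: exp_cnj)
    then show ?thesis
      by (simp only: Bochner_Integration.integral_cnj ft) simp
  qed
  have "AE t in lebesgue. Re (g t) = 0"
  proof (rule Fourier_injective_real)
    fix y
    have *: "iexp (y * t) * of_real (Re (g t)) = (iexp (y * t) * g t + iexp (y * t) * cnj (g t)) / 2" for t
      by (simp add: complex_add_cnj flip: distrib_left)
    show "(\<integral>t. iexp (y * t) * of_real (Re (g t)) \<partial>lebesgue) = 0"
      unfolding * using int[OF g, of y] int[OF gc, of y] by (simp add: ft ftc del: of_real_mult)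
  qed (use g in auto)
  moreover have "AE t in lebesgue. Im (g t) = 0"
  proof (rule Fourier_injective_real)
    fix y
    have *: "iexp (y * t) * of_real (Im (g t)) = (iexp (y * t) * g t - iexp (y * t) * cnj (g t)) / (2 * \<i>)" for t
      unfolding right_diff_distrib[symmetric] complex_diff_cnj by (simp add: mult.assoc mult.left_commute[of \<i>])
    show "(\<integral>t. iexp (y * t) * of_real (Im (g t)) \<partial>lebesgue) = 0"
      unfolding * using int[OF g, of y] int[OF gc, of y] by (simp add: ft ftc del: of_real_mult)
  qed (use g in auto)
  ultimately show ?thesis
    by eventually_elim (simp add: complex_eq_iff)
qed

section \<open>Totality of the Hermite functions\<close>

context bargmann
begin

text \<open>If all Hermite coefficients of \<open>h\<close> vanish, so does its integral against
  \<open>gker t z\<close> for every complex z. On the imaginary axis this integral is, up to a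
  nonzero factor, the Fourier transform of the integrable function \<open>g\<close>, a nowhere
  vanishing Gaussian times \<open>h\<close>.\<close>

lemma herm_total:
  assumes h: "h \<in> L2 lebesgue" and 0: "\<And>n. L2_inner lebesgue h (\<lambda>t. of_real (herm n t)) = 0"
  shows "AE t in lebesgue. h t = 0"
proof -
  define g where "g t = gker t 0 * h t" for t
  have "(\<integral>t. of_real (herm n t) * h t \<partial>lebesgue) = 0" for n
    using 0[of n] by (simp add: L2_inner_def mult.commute)
  then have tr: "(\<integral>t. gker t z * h t \<partial>lebesgue) = 0" for z
    using gker_transform_sums[OF h, of z] by (simp add: sums_iff)
  have "AE t in lebesgue. g t = 0"
  proof (rule Fourier_injective)
    show "integrable lebesgue g"
      unfolding g_def[abs_def] by (intro L2_mult_integrable gker_L2 h)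
    fix y
    \<comment> \<open>Chosen so that the linear term of the exponent,
      \<open>kap * t / s * z\<close>, becomes \<i> y t. The remaining factor exp(bet/2 z^2) does not
      involve \<open>t\<close>.\<close>
    define z where "z = \<i> * of_real (y * s / kap)"
    have "iexp (y * t) * g t = exp (of_real (bet / 2) * z\<^sup>2) * (gker t z * h t)" for t
    proof -
      have "of_real (kap * t / s) * z = \<i> * of_real (y * t)"
        using kap_pos s_pos by (simp add: z_def)
      then have "iexp (y * t) * gker t 0 = exp (of_real (bet / 2) * z\<^sup>2) * gker t z"
        unfolding gker_def exp_add[symmetric] by (intro arg_cong[of _ _ exp]) simp
      then show ?thesis
        by (simp add: g_def mult.assoc[symmetric])
    qed
    then show "(\<integral>t. iexp (y * t) * g t \<partial>lebesgue) = 0"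
      by (simp add: tr)
  qed
  then show ?thesis
    by eventually_elim (simp add: g_def gker_def)
qed

end

section \<open>The Fock space norm of a power series\<close>

lemma borel_measurable_Complex [measurable]:
  "f \<in> borel_measurable M \<Longrightarrow> g \<in> borel_measurable M \<Longrightarrow> (\<lambda>x. Complex (f x) (g x)) \<in> borel_measurable M"
  unfolding Complex_eq
  by (intro borel_measurable_add borel_measurable_times borel_measurable_const
      borel_measurable_continuous_on[OF continuous_on_of_real_id])

text \<open>A box in the plane is a rectangle in real and imaginary part, and \<open>lborel\<close>
  is characterised by its values on boxes.\<close>

lemma lborel_complex: "lborel = distr (lborel \<Otimes>\<^sub>M lborel) borel (\<lambda>(x, y). Complex x y)"
proof (rule lborel_eqI)
  fix l u :: complex assume le: "\<And>b. b \<in> Basis \<Longrightarrow> l \<bullet> b \<le> u \<bullet> b"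
  have "(\<lambda>(x, y). Complex x y) -` box l u = {Re l<..<Re u} \<times> {Im l<..<Im u}"
    by (auto simp: box_def Basis_complex_def)
  then have "emeasure (distr (lborel \<Otimes>\<^sub>M lborel) borel (\<lambda>(x, y). Complex x y)) (box l u)
      = emeasure (lborel \<Otimes>\<^sub>M lborel) ({Re l<..<Re u} \<times> {Im l<..<Im u})"
    by (subst emeasure_distr) (auto simp: space_pair_measure)
  also have "\<dots> = ennreal (Re u - Re l) * ennreal (Im u - Im l)"
    using le[of 1] le[of \<i>] by (subst lborel.emeasure_pair_measure_Times) (auto simp: Basis_complex_def)
  also have "\<dots> = ennreal (\<Prod>b\<in>Basis. (u - l) \<bullet> b)"
    using le[of 1] le[of \<i>] by (simp add: Basis_complex_def ennreal_mult complex_eq_iff)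
  finally show "emeasure (distr (lborel \<Otimes>\<^sub>M lborel) borel (\<lambda>(x, y). Complex x y)) (box l u)
      = ennreal (\<Prod>b\<in>Basis. (u - l) \<bullet> b)" .
qed simp

lemma nn_integral_lborel_complex:
  assumes [measurable]: "f \<in> borel_measurable borel"
  shows "(\<integral>\<^sup>+z. f z \<partial>lborel) = (\<integral>\<^sup>+x. \<integral>\<^sup>+y. f (Complex x y) \<partial>lborel \<partial>lborel)"
proof -
  have "(\<integral>\<^sup>+z. f z \<partial>lborel) = (\<integral>\<^sup>+p. f (case p of (x, y) \<Rightarrow> Complex x y) \<partial>(lborel \<Otimes>\<^sub>M lborel))"
    by (subst lborel_complex) (simp add: nn_integral_distr)
  also have "\<dots> = (\<integral>\<^sup>+x. \<integral>\<^sup>+y. f (Complex x y) \<partial>lborel \<partial>lborel)"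
    by (subst lborel.nn_integral_fst[symmetric]) auto
  finally show ?thesis .
qed

text \<open>A rotation by an angle that is not a right one factors into two affine substitutions in one
  real variable each: first \<open>u = c x - d y\<close> for fixed \<open>y\<close>, then \<open>v = (d u + y) / c\<close> for fixed \<open>u\<close>.\<close>

lemma nn_integral_rotation:
  fixes w :: complex
  assumes [measurable]: "f \<in> borel_measurable borel" and w: "cmod w = 1"
  shows "(\<integral>\<^sup>+z. f (w * z) \<partial>lborel) = (\<integral>\<^sup>+z. f z \<partial>lborel)"
proof -
  define c d where "c = Re w" and "d = Im w"
  have cd: "c\<^sup>2 + d\<^sup>2 = 1"
    using w by (simp add: c_def d_def cmod_def)
  have wz: "w * Complex x y = Complex (c * x - d * y) (d * x + c * y)" for x y
    by (simp add: c_def d_def complex_eq_iff)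
  have swap: "(\<integral>\<^sup>+x. \<integral>\<^sup>+y. g x y \<partial>lborel \<partial>lborel) = (\<integral>\<^sup>+y. \<integral>\<^sup>+x. g x y \<partial>lborel \<partial>lborel)"
    if "case_prod g \<in> borel_measurable (lborel \<Otimes>\<^sub>M lborel)" for g :: "real \<Rightarrow> real \<Rightarrow> ennreal"
    using lborel_pair.Fubini'[OF that] by simp
  have "(\<integral>\<^sup>+z. f (w * z) \<partial>lborel)
      = (\<integral>\<^sup>+x. \<integral>\<^sup>+y. f (Complex (c * x - d * y) (d * x + c * y)) \<partial>lborel \<partial>lborel)"
    by (subst nn_integral_lborel_complex) (auto simp: wz)
  also have "\<dots> = (\<integral>\<^sup>+x. \<integral>\<^sup>+y. f (Complex x y) \<partial>lborel \<partial>lborel)"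
  proof (cases "c = 0")
    \<comment> \<open>A right angle: \<open>d\<close> is a sign, so the rotation is a sign change in
      each coordinate combined with an exchange of the two.\<close>
    case True
    with cd have d: "d \<noteq> 0" "\<bar>d\<bar> = 1"
      by (auto simp: power2_eq_1_iff)
    have "(\<integral>\<^sup>+x. \<integral>\<^sup>+y. f (Complex x y) \<partial>lborel \<partial>lborel) = (\<integral>\<^sup>+x. \<integral>\<^sup>+y. f (Complex x (0 + d * y)) \<partial>lborel \<partial>lborel)"
      using d nn_integral_real_affine[of "\<lambda>y. f (Complex x y)" d 0 for x] by simp
    also have "\<dots> = (\<integral>\<^sup>+x. \<integral>\<^sup>+y. f (Complex (0 + (- d) * x) (0 + d * y)) \<partial>lborel \<partial>lborel)"
      using d by (subst nn_integral_real_affine[where c="-d" and t=0]) auto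
    also have "\<dots> = (\<integral>\<^sup>+y. \<integral>\<^sup>+x. f (Complex (0 + (- d) * x) (0 + d * y)) \<partial>lborel \<partial>lborel)"
      by (rule swap) measurable
    finally show ?thesis
      using True by simp
  next
    case False
    have "(\<integral>\<^sup>+x. \<integral>\<^sup>+y. f (Complex (c * x - d * y) (d * x + c * y)) \<partial>lborel \<partial>lborel)
        = (\<integral>\<^sup>+y. \<integral>\<^sup>+x. f (Complex (c * x - d * y) (d * x + c * y)) \<partial>lborel \<partial>lborel)"
      by (rule swap) measurable
    also have "\<dots> = (\<integral>\<^sup>+y. ennreal \<bar>1/c\<bar> * (\<integral>\<^sup>+u. f (Complex u (d / c * u + 1 / c * y)) \<partial>lborel) \<partial>lborel)"
    proof (rule nn_integral_cong)
      fix y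
      have *: "c * (d / c * y + 1 / c * u) - d * y = u" for u
        using False by (simp add: field_simps)
      have "d * (d / c * y + 1 / c * u) + c * y = d / c * u + (d\<^sup>2 + c\<^sup>2) / c * y" for u
        using False by (simp add: field_simps power2_eq_square)
      then have **: "d * (d / c * y + 1 / c * u) + c * y = d / c * u + 1 / c * y" for u
        using cd by (simp add: add.commute)
      show "(\<integral>\<^sup>+x. f (Complex (c * x - d * y) (d * x + c * y)) \<partial>lborel)
          = ennreal \<bar>1/c\<bar> * (\<integral>\<^sup>+u. f (Complex u (d / c * u + 1 / c * y)) \<partial>lborel)"
        using False by (subst nn_integral_real_affine[where c="1/c" and t="d/c*y"]) (auto simp only: * **, auto)
    qed
    also have "\<dots> = ennreal \<bar>1/c\<bar> * (\<integral>\<^sup>+y. \<integral>\<^sup>+u. f (Complex u (d / c * u + 1 / c * y)) \<partial>lborel \<partial>lborel)"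
      by (rule nn_integral_cmult) measurable
    also have "(\<integral>\<^sup>+y. \<integral>\<^sup>+u. f (Complex u (d / c * u + 1 / c * y)) \<partial>lborel \<partial>lborel)
        = (\<integral>\<^sup>+u. \<integral>\<^sup>+y. f (Complex u (d / c * u + 1 / c * y)) \<partial>lborel \<partial>lborel)"
      by (rule swap) measurable
    also have "ennreal \<bar>1/c\<bar> * \<dots> = (\<integral>\<^sup>+u. ennreal \<bar>1/c\<bar> * (\<integral>\<^sup>+y. f (Complex u (d / c * u + 1 / c * y)) \<partial>lborel) \<partial>lborel)"
      by (rule nn_integral_cmult[symmetric]) measurable
    also have "\<dots> = (\<integral>\<^sup>+u. \<integral>\<^sup>+v. f (Complex u v) \<partial>lborel \<partial>lborel)"
      using False by (intro nn_integral_cong) (subst nn_integral_real_affine[where c="1/c", symmetric], auto)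
    finally show ?thesis .
  qed
  also have "\<dots> = (\<integral>\<^sup>+z. f z \<partial>lborel)"
    by (subst nn_integral_lborel_complex) auto
  finally show ?thesis .
qed

section \<open>Averages over the circle\<close>

text \<open>Angles are measured in turns: \<open>x\<close> stands for the rotation
  \<open>cis (2 * pi * x)\<close>, and total mass 1 makes the integral an average over all
  rotations.\<close>

abbreviation unit_interval_measure :: "real measure" where
  "unit_interval_measure \<equiv> density lborel (indicator {0..1})"

lemma prob_space_unit_interval: "prob_space unit_interval_measure"
  by (rule prob_spaceI) (simp add: emeasure_density)

lemma integral_cis:
  fixes k :: int
  shows "(\<integral>x. cis (2 * pi * k * x) \<partial>unit_interval_measure) = (if k = 0 then 1 else 0)"
proof -
  have "(\<integral>x. cis (2 * pi * k * x) \<partial>density lborel (\<lambda>x. ennreal (indicator {0..1} x)))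
      = (\<integral>x. indicator {0..1} x *\<^sub>R cis (2 * pi * k * x) \<partial>lborel)"
    by (rule integral_density) (auto intro!: borel_measurable_continuous_onI continuous_intros)
  then have "(\<integral>x. cis (2 * pi * k * x) \<partial>unit_interval_measure)
      = (\<integral>x. indicator {0..1} x *\<^sub>R cis (2 * pi * k * x) \<partial>lborel)"
    by (simp add: ennreal_indicator)
  also have "\<dots> = (if k = 0 then 1 else 0)"
  proof (cases "k = 0")
    case False
    define F where "F x = cis (2 * pi * k * x) / (2 * pi * k * \<i>)" for x
    have "(\<integral>x. indicator {0..1} x *\<^sub>R cis (2 * pi * k * x) \<partial>lborel) = F 1 - F 0"
    proof (rule integral_FTC_Icc)
      fix x :: real
      show "(F has_vector_derivative cis (2 * pi * k * x)) (at x within {0..1})"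
        using False unfolding F_def cis_conv_exp
        by (auto intro!: derivative_eq_intros has_vector_derivative_real_field simp: field_simps)
    qed (auto intro!: continuous_intros)
    also have "cis (2 * pi * k * 1) = 1"
      using cis_multiple_2pi[of "real_of_int k"] by (simp add: mult.commute)
    then have "F 1 - F 0 = 0"
      by (simp add: F_def)
    finally show ?thesis using False by simp
  qed simp
  finally show ?thesis .
qed

interpretation circle: L2_orthogonal unit_interval_measure "\<lambda>n x. cis (2 * pi * real n * x)" "\<lambda>n. 1"
proof
  interpret prob_space unit_interval_measure by (rule prob_space_unit_interval)
  fix m n :: nat
  have "(\<lambda>x. cis (2 * pi * real n * x)) \<in> borel_measurable borel"
    by (auto intro!: borel_measurable_continuous_onI continuous_intros)
  then show "(\<lambda>x. cis (2 * pi * real n * x)) \<in> L2 unit_interval_measure"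
    by (simp add: L2_def)
  have "cis (2 * pi * real m * x) * cnj (cis (2 * pi * real n * x)) = cis (2 * pi * of_int (int m - int n) * x)" for x
    by (simp add: cis_cnj cis_mult ring_distribs)
  then show "L2_inner unit_interval_measure (\<lambda>x. cis (2 * pi * real m * x)) (\<lambda>x. cis (2 * pi * real n * x))
      = (if m = n then complex_of_real 1 else 0)"
    unfolding L2_inner_def by (simp only: integral_cis) auto
qed simp

text \<open>Along a circle the partial sums are finite combinations of characters, to which
  Pythagoras applies. They are bounded by the absolute series at radius \<open>cmod z\<close>, so
  dominated convergence passes to the limit.\<close>

lemma powser_circle_Parseval:
  assumes H: "\<And>z. (\<lambda>n. a n * z ^ n) sums H z"
  shows "integrable unit_interval_measure (\<lambda>x. (cmod (H (cis (2 * pi * x) * z)))\<^sup>2)"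
    and "(\<lambda>n. (cmod (a n))\<^sup>2 * (cmod z) ^ (2 * n)) sums
    (\<integral>x. (cmod (H (cis (2 * pi * x) * z)))\<^sup>2 \<partial>unit_interval_measure)"
proof -
  interpret prob_space unit_interval_measure by (rule prob_space_unit_interval)
  define r where "r = cmod z"
  \<comment> \<open>Convergence at the larger radius r + 1 gives absolute convergence at r.\<close>
  have "norm (complex_of_real r) < norm (complex_of_real (r + 1))"
    by (simp add: r_def)
  from powser_insidea[OF sums_summable[OF H] this]
  have sm: "summable (\<lambda>n. cmod (a n) * r ^ n)"
    by (simp add: norm_mult norm_power r_def)
  define B where "B = (\<Sum>n. cmod (a n) * r ^ n)"
  define P where "P N x = (\<Sum>n<N. a n * z ^ n * cis (2 * pi * real n * x))" for N x
  have summand: "a n * (cis (2 * pi * x) * z) ^ n = a n * z ^ n * cis (2 * pi * real n * x)" for n x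
    by (simp add: power_mult_distrib Complex.DeMoivre mult_ac)
  have lim: "(\<lambda>N. P N x) \<longlonglongrightarrow> H (cis (2 * pi * x) * z)" for x
    using H[of "cis (2 * pi * x) * z"] by (simp add: sums_def P_def summand)
  have [measurable]: "P N \<in> borel_measurable borel" for N
    unfolding P_def[abs_def] by (intro borel_measurable_continuous_onI continuous_intros)
  have meas: "(\<lambda>x. H (cis (2 * pi * x) * z)) \<in> borel_measurable borel"
    by (rule borel_measurable_LIMSEQ_metric[OF _ lim]) measurable
  have bound: "cmod (P N x) \<le> B" for N x
  proof -
    have "cmod (P N x) \<le> (\<Sum>n<N. cmod (a n) * r ^ n)"
      unfolding P_def by (rule order_trans[OF norm_sum]) (simp add: norm_mult norm_power r_def)
    also have "\<dots> \<le> B"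
      unfolding B_def by (intro sum_le_suminf sm) (auto simp: r_def)
    finally show ?thesis .
  qed
  have *: "(\<lambda>x. (cmod (H (cis (2 * pi * x) * z)))\<^sup>2) \<in> borel_measurable unit_interval_measure"
      "(\<lambda>x. (cmod (P N x))\<^sup>2) \<in> borel_measurable unit_interval_measure"
      "integrable unit_interval_measure (\<lambda>_. B\<^sup>2)"
      "AE x in unit_interval_measure. (\<lambda>N. (cmod (P N x))\<^sup>2) \<longlonglongrightarrow> (cmod (H (cis (2 * pi * x) * z)))\<^sup>2"
      "AE x in unit_interval_measure. norm ((cmod (P N x))\<^sup>2) \<le> B\<^sup>2" for N
    using meas bound by (auto intro!: always_eventually tendsto_intros lim power_mono)
  show "integrable unit_interval_measure (\<lambda>x. (cmod (H (cis (2 * pi * x) * z)))\<^sup>2)"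
    by (rule integrable_dominated_convergence[OF *])
  have "(\<lambda>N. \<integral>x. (cmod (P N x))\<^sup>2 \<partial>unit_interval_measure)
      \<longlonglongrightarrow> (\<integral>x. (cmod (H (cis (2 * pi * x) * z)))\<^sup>2 \<partial>unit_interval_measure)"
    by (rule integral_dominated_convergence[OF *])
  moreover have "(\<integral>x. (cmod (P N x))\<^sup>2 \<partial>unit_interval_measure) = (\<Sum>n<N. (cmod (a n))\<^sup>2 * (cmod z) ^ (2 * n))" for N
    unfolding P_def by (subst circle.norm_lincomb) (simp_all add: norm_mult norm_power power_mult_distrib power_mult[symmetric] mult.commute)
  ultimately show "(\<lambda>n. (cmod (a n))\<^sup>2 * (cmod z) ^ (2 * n)) sums
      (\<integral>x. (cmod (H (cis (2 * pi * x) * z)))\<^sup>2 \<partial>unit_interval_measure)"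
    by (simp add: sums_def)
qed

lemma powser_holomorphic:
  assumes H: "\<And>z. (\<lambda>n. a n * z ^ n) sums H z"
  shows "H holomorphic_on UNIV"
proof -
  have "H field_differentiable (at z)" for z
  proof -
    have "H holomorphic_on ball 0 (cmod z + 1)"
      by (rule power_series_holomorphic) (use H in simp)
    then show ?thesis
      by (rule holomorphic_on_imp_differentiable_at) auto
  qed
  then show ?thesis
    by (simp add: holomorphic_on_def field_differentiable_at_within)
qed

lemma entire_borel_measurable:
  "F holomorphic_on UNIV \<Longrightarrow> F \<in> borel_measurable borel"
  by (intro borel_measurable_continuous_onI holomorphic_on_imp_continuous_on)

text \<open>Rotation invariance permits averaging the integrand over all rotations of z. The weight
  is radial and stays put, while the average of the squared power series loses its cross terms. Both
  sides may be infinite, so the identity also decides integrability.\<close>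

lemma nn_integral_powser_radial:
  assumes H: "\<And>z. (\<lambda>n. a n * z ^ n) sums H z"
    and [measurable]: "g \<in> borel_measurable borel"
  shows "(\<integral>\<^sup>+z. ennreal ((cmod (H z))\<^sup>2) * g (cmod z) \<partial>lborel)
    = (\<Sum>n. ennreal ((cmod (a n))\<^sup>2) * (\<integral>\<^sup>+z. ennreal ((cmod z) ^ (2 * n)) * g (cmod z) \<partial>lborel))"
proof -
  interpret U: prob_space unit_interval_measure by (rule prob_space_unit_interval)
  interpret P: pair_sigma_finite unit_interval_measure "lborel :: complex measure"
    by unfold_locales
  have [measurable]: "H \<in> borel_measurable borel"
    by (rule entire_borel_measurable[OF powser_holomorphic[OF H]])
  have [measurable]: "cis \<in> borel_measurable borel"
    by (intro borel_measurable_continuous_onI continuous_intros)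
  define \<phi> where "\<phi> z = ennreal ((cmod (H z))\<^sup>2) * g (cmod z)" for z
  have [measurable]: "\<phi> \<in> borel_measurable borel"
    unfolding \<phi>_def[abs_def] by measurable
  \<comment> \<open>The inner integral on the right is constant in \<open>x\<close>, and the outer
    measure has mass 1.\<close>
  have "(\<integral>\<^sup>+z. \<phi> z \<partial>lborel) = (\<integral>\<^sup>+x. (\<integral>\<^sup>+z. \<phi> (cis (2 * pi * x) * z) \<partial>lborel) \<partial>unit_interval_measure)"
    using U.emeasure_space_1 by (simp add: nn_integral_rotation)
  also have "\<dots> = (\<integral>\<^sup>+z. (\<integral>\<^sup>+x. \<phi> (cis (2 * pi * x) * z) \<partial>unit_interval_measure) \<partial>lborel)"
    by (rule P.Fubini'[symmetric]) measurable
  also have "\<dots> = (\<integral>\<^sup>+z. (\<Sum>n. ennreal ((cmod (a n))\<^sup>2) * (ennreal ((cmod z) ^ (2 * n)) * g (cmod z))) \<partial>lborel)"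
  proof (rule nn_integral_cong)
    fix z
    define J where "J = (\<integral>x. (cmod (H (cis (2 * pi * x) * z)))\<^sup>2 \<partial>unit_interval_measure)"
    have J: "(\<lambda>n. (cmod (a n))\<^sup>2 * (cmod z) ^ (2 * n)) sums J"
      unfolding J_def by (rule powser_circle_Parseval[OF H])
    have "integrable unit_interval_measure (\<lambda>x. (cmod (H (cis (2 * pi * x) * z)))\<^sup>2)"
      by (rule powser_circle_Parseval[OF H])
    then have "(\<integral>\<^sup>+x. ennreal ((cmod (H (cis (2 * pi * x) * z)))\<^sup>2) \<partial>unit_interval_measure) = ennreal J"
      unfolding J_def by (intro nn_integral_eq_integral) auto
    also have "\<dots> = (\<Sum>n. ennreal ((cmod (a n))\<^sup>2 * (cmod z) ^ (2 * n)))"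
      using J by (subst suminf_ennreal_eq[OF _ J]) auto
    finally have "(\<integral>\<^sup>+x. ennreal ((cmod (H (cis (2 * pi * x) * z)))\<^sup>2) \<partial>unit_interval_measure)
        = (\<Sum>n. ennreal ((cmod (a n))\<^sup>2 * (cmod z) ^ (2 * n)))" .
    then show "(\<integral>\<^sup>+x. \<phi> (cis (2 * pi * x) * z) \<partial>unit_interval_measure)
        = (\<Sum>n. ennreal ((cmod (a n))\<^sup>2) * (ennreal ((cmod z) ^ (2 * n)) * g (cmod z)))"
      unfolding \<phi>_def norm_mult norm_cis
      by (simp add: nn_integral_multc ennreal_suminf_multc[symmetric] ennreal_mult mult.assoc)
  qed
  also have "\<dots> = (\<Sum>n. \<integral>\<^sup>+z. ennreal ((cmod (a n))\<^sup>2) * (ennreal ((cmod z) ^ (2 * n)) * g (cmod z)) \<partial>lborel)"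
    by (rule nn_integral_suminf) measurable
  also have "\<dots> = (\<Sum>n. ennreal ((cmod (a n))\<^sup>2) * (\<integral>\<^sup>+z. ennreal ((cmod z) ^ (2 * n)) * g (cmod z) \<partial>lborel))"
    by (intro suminf_cong nn_integral_cmult) measurable
  finally show ?thesis
    by (simp add: \<phi>_def)
qed

lemma sums_if_suminf_ennreal:
  assumes "(\<Sum>n. ennreal (f n)) = ennreal x" "\<And>n. f n \<ge> 0" "x \<ge> 0"
  shows "f sums x"
proof -
  have "summable f"
    using assms by (intro summable_suminf_not_top) auto
  moreover from this have "ennreal (suminf f) = ennreal x"
    using assms by (simp add: suminf_ennreal2)
  ultimately show ?thesis
    using assms by (auto simp: sums_iff suminf_nonneg)
qed

section \<open>Gaussian moments in the plane\<close>

lemma nn_integral_gaussian_complex: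
  assumes "c > 0"
  shows "(\<integral>\<^sup>+z. ennreal (exp (- c * (cmod z)\<^sup>2)) \<partial>lborel) = ennreal (pi / c)"
proof -
  have g: "(\<integral>\<^sup>+x. ennreal (exp (- c * x\<^sup>2)) \<partial>lborel) = ennreal (sqrt (pi / c))"
    using has_bochner_integral_gaussian[OF assms, of 0]
    by (subst nn_integral_eq_integral) (auto simp: has_bochner_integral_iff)
  have "(\<integral>\<^sup>+z. ennreal (exp (- c * (cmod z)\<^sup>2)) \<partial>lborel)
      = (\<integral>\<^sup>+x. \<integral>\<^sup>+y. ennreal (exp (- c * x\<^sup>2)) * ennreal (exp (- c * y\<^sup>2)) \<partial>lborel \<partial>lborel)"
    by (subst nn_integral_lborel_complex)
      (auto simp: cmod_power2 ennreal_mult[symmetric] exp_add[symmetric] distrib_left right_diff_distrib)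
  also have "\<dots> = ennreal (sqrt (pi / c)) * ennreal (sqrt (pi / c))"
    using g by (simp add: nn_integral_cmult nn_integral_multc)
  also have "\<dots> = ennreal (pi / c)"
    using assms by (simp flip: ennreal_mult)
  finally show ?thesis .
qed

text \<open>All moments are found at once: weighted by x^n / n! they sum to the integral of the
  Gaussian with parameter b - x, namely pi / (b - x). Its geometric series in x / b gives the
  values.\<close>

lemma nn_integral_gaussian_moment:
  assumes b: "b > 0"
  shows "(\<integral>\<^sup>+z. ennreal ((cmod z) ^ (2 * n)) * ennreal (exp (- b * (cmod z)\<^sup>2)) \<partial>lborel)
    = ennreal (pi * fact n / b ^ Suc n)"
proof -
  define M where "M n = (\<integral>\<^sup>+z. ennreal ((cmod z) ^ (2 * n)) * ennreal (exp (- b * (cmod z)\<^sup>2)) \<partial>lborel)" for n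
  have gen: "(\<Sum>n. ennreal (x ^ n / fact n) * M n) = ennreal (pi / (b - x))" if "0 < x" "x < b" for x
  proof -
    have "(\<Sum>n. ennreal (x ^ n / fact n) * M n)
        = (\<Sum>n. \<integral>\<^sup>+z. ennreal (x ^ n / fact n) * (ennreal ((cmod z) ^ (2 * n)) * ennreal (exp (- b * (cmod z)\<^sup>2))) \<partial>lborel)"
      unfolding M_def by (intro suminf_cong nn_integral_cmult[symmetric]) measurable
    also have "\<dots> = (\<integral>\<^sup>+z. (\<Sum>n. ennreal (x ^ n / fact n) * (ennreal ((cmod z) ^ (2 * n)) * ennreal (exp (- b * (cmod z)\<^sup>2)))) \<partial>lborel)"
      by (rule nn_integral_suminf[symmetric]) measurable
    also have "\<dots> = (\<integral>\<^sup>+z. ennreal (exp (- (b - x) * (cmod z)\<^sup>2)) \<partial>lborel)"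
    proof (rule nn_integral_cong)
      fix z :: complex
      have "(\<Sum>n. ennreal (x ^ n / fact n) * (ennreal ((cmod z) ^ (2 * n)) * ennreal (exp (- b * (cmod z)\<^sup>2))))
          = (\<Sum>n. ennreal (x ^ n / fact n * ((cmod z)\<^sup>2) ^ n * exp (- b * (cmod z)\<^sup>2)))"
      proof (intro suminf_cong)
        fix n
        have "ennreal p * (ennreal q * ennreal r) = ennreal (p * q * r)" if "p \<ge> 0" "q \<ge> 0" "r \<ge> 0" for p q r
          using that by (simp add: ennreal_mult mult.assoc)
        from this[of "x ^ n / fact n" "((cmod z)\<^sup>2) ^ n" "exp (- b * (cmod z)\<^sup>2)"] \<open>0 < x\<close>
        show "ennreal (x ^ n / fact n) * (ennreal ((cmod z) ^ (2 * n)) * ennreal (exp (- b * (cmod z)\<^sup>2)))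
            = ennreal (x ^ n / fact n * ((cmod z)\<^sup>2) ^ n * exp (- b * (cmod z)\<^sup>2))"
          by (simp add: power_mult)
      qed
      also have "\<dots> = ennreal (exp (x * (cmod z)\<^sup>2) * exp (- b * (cmod z)\<^sup>2))"
        using \<open>0 < x\<close> by (intro suminf_ennreal_eq sums_mult2 exp_powser_sums) auto
      also have "exp (x * (cmod z)\<^sup>2) * exp (- b * (cmod z)\<^sup>2) = exp (- (b - x) * (cmod z)\<^sup>2)"
        by (simp add: exp_add[symmetric] algebra_simps)
      finally show "(\<Sum>n. ennreal (x ^ n / fact n) * (ennreal ((cmod z) ^ (2 * n)) * ennreal (exp (- b * (cmod z)\<^sup>2))))
          = ennreal (exp (- (b - x) * (cmod z)\<^sup>2))" .
    qed
    also have "\<dots> = ennreal (pi / (b - x))"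
      using that by (intro nn_integral_gaussian_complex) simp
    finally show ?thesis .
  qed
  \<comment> \<open>Coefficients can be compared only for real moments, so finiteness comes
    beforehand: at x = b/2 each weighted moment is at most the finite sum.\<close>
  have fin: "M n < \<infinity>" for n
  proof -
    have "ennreal ((b/2) ^ n / fact n) * M n \<le> (\<Sum>n. ennreal ((b/2) ^ n / fact n) * M n)"
      using sum_le_suminf[of "\<lambda>n. ennreal ((b/2) ^ n / fact n) * M n" "{n}"] by (simp add: summableI)
    also have "\<dots> < \<infinity>"
      using gen[of "b/2"] b by simp
    finally show ?thesis
      using b by (auto simp: ennreal_mult_less_top)
  qed
  define m where "m n = enn2real (M n)" for n
  have m: "M n = ennreal (m n)" "m n \<ge> 0" for n
    using fin[of n] by (auto simp: m_def)
  have "(\<lambda>n. complex_of_real (m n / fact n)) = (\<lambda>n. complex_of_real (pi / b ^ Suc n))"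
  proof (rule powser_coeffs_unique[OF b])
    fix x :: real assume x: "0 < x" "x < b"
    have "(\<Sum>n. ennreal (x ^ n / fact n * m n)) = ennreal (pi / (b - x))"
      using gen[OF x] x unfolding m(1) by (subst ennreal_mult) (auto simp: m(2))
    then have "(\<lambda>n. x ^ n / fact n * m n) sums (pi / (b - x))"
    proof (rule sums_if_suminf_ennreal)
      show "0 \<le> x ^ n / fact n * m n" for n
        using x m(2) by simp
      show "0 \<le> pi / (b - x)"
        using x by simp
    qed
    then have "(\<lambda>n. complex_of_real (x ^ n / fact n * m n)) sums of_real (pi / (b - x))"
      by (rule sums_of_real)
    moreover have "complex_of_real (x ^ n / fact n * m n) = complex_of_real (m n / fact n) * of_real x ^ n" for n
      by simp
    ultimately show "(\<lambda>n. complex_of_real (m n / fact n) * of_real x ^ n) sums of_real (pi / (b - x))"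
      by (simp only:)
    have "(\<lambda>n. pi / b * (x / b) ^ n) sums (pi / b * (1 / (1 - x / b)))"
      using x by (intro sums_mult geometric_sums) simp
    also have "pi / b * (1 / (1 - x / b)) = pi / (b - x)"
      using x by (simp add: field_simps)
    finally have "(\<lambda>n. complex_of_real (pi / b * (x / b) ^ n)) sums of_real (pi / (b - x))"
      by (rule sums_of_real)
    moreover have "complex_of_real (pi / b * (x / b) ^ n) = complex_of_real (pi / b ^ Suc n) * of_real x ^ n" for n
      by (simp add: power_divide)
    ultimately show "(\<lambda>n. complex_of_real (pi / b ^ Suc n) * of_real x ^ n) sums of_real (pi / (b - x))"
      by (simp only:)
  qed
  then have "complex_of_real (m n / fact n) = complex_of_real (pi / b ^ Suc n)"
    by meson
  then have "m n = pi * fact n / b ^ Suc n"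
    by (simp only: of_real_eq_iff) (simp add: field_simps)
  then show ?thesis
    using m(1)[of n] by (simp add: M_def)
qed

section \<open>The transform\<close>

text \<open>Polarization: equal norms of all combinations give equal real parts after multiplication
  by any \<open>cnj a\<close>. Taking \<open>a\<close> as 1 and \<i> recovers both parts of the
  inner product.\<close>

lemma L2_inner_eqI_isometry:
  assumes "f \<in> L2 M" "g \<in> L2 M" "f' \<in> L2 N" "g' \<in> L2 N"
    and norm: "\<And>a b. (\<integral>x. (cmod (a * f' x + b * g' x))\<^sup>2 \<partial>N) = (\<integral>x. (cmod (a * f x + b * g x))\<^sup>2 \<partial>M)"
  shows "L2_inner N f' g' = L2_inner M f g"
proof -
  have Re: "Re (cnj a * L2_inner N f' g') = Re (cnj a * L2_inner M f g)" for a
    using norm[of 1 a] norm[of 1 0] norm[of 0 1]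
      L2_norm_lincomb[OF assms(1,2), of a] L2_norm_lincomb[OF assms(3,4), of a] by simp
  show ?thesis
    using Re[of 1] Re[of \<i>] by (simp add: complex_eq_iff)
qed

lemma entire_powser:
  assumes "F holomorphic_on UNIV"
  shows "(\<lambda>n. (deriv ^^ n) F 0 / fact n * z ^ n) sums F z"
proof -
  have "F holomorphic_on ball 0 (cmod z + 1)"
    using assms by (rule holomorphic_on_subset) simp
  from holomorphic_power_series[OF this, of z] show ?thesis
    by simp
qed

context bargmann
begin

definition gauss_factor :: "complex \<Rightarrow> complex" where
  "gauss_factor z = exp (of_real ((1 + s\<^sup>2) / (4 * s)) * z\<^sup>2)"

definition B_const :: real where
  "B_const = sqrt ((1 - s\<^sup>2) / (2 * pi * s * sqrt (s * pi)))"

lemma gauss_factor_nonzero [simp]: "gauss_factor z \<noteq> 0"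
  by (simp add: gauss_factor_def)

lemma gauss_factor_holomorphic: "gauss_factor holomorphic_on A"
  unfolding gauss_factor_def[abs_def] by (intro holomorphic_intros)

lemma B_const_sq: "B_const\<^sup>2 = bet / (pi * sqrt (pi * s))"
proof -
  have "bet / (pi * sqrt (pi * s)) = (1 - s\<^sup>2) / (2 * pi * s * sqrt (s * pi))"
    by (simp add: bet_def mult_ac)
  moreover from this have "(1 - s\<^sup>2) / (2 * pi * s * sqrt (s * pi)) \<ge> 0"
    using bet_pos s_pos by (metis divide_nonneg_pos less_imp_le mult_pos_pos pi_gt_zero real_sqrt_gt_zero)
  ultimately show ?thesis
    by (simp add: B_const_def)
qed

lemma B_const_pos: "B_const > 0"
proof -
  have "B_const \<ge> 0"
    using bet_pos s_pos by (simp add: B_const_def bet_def zero_less_divide_iff)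
  moreover have "B_const\<^sup>2 > 0"
    using bet_pos s_pos by (simp add: B_const_sq)
  ultimately show ?thesis
    by (cases "B_const = 0") auto
qed

text \<open>Only the coefficient of z^2 changes: -1/(2s) + (1 + s^2)/(4s) = -bet/2.\<close>

lemma B_kernel_eq: "B_kernel s t z * gauss_factor z = of_real B_const * gker t z"
proof -
  have "bet / 2 = 1 / (2 * s) - (1 + s\<^sup>2) / (4 * s)"
    using s_pos by (simp add: bet_def field_simps)
  then have b: "complex_of_real (bet / 2) = of_real (1 / (2 * s)) - of_real ((1 + s\<^sup>2) / (4 * s))"
    by (simp only: of_real_diff)
  have "- complex_of_real (1 / (2 * s)) * (complex_of_real t)\<^sup>2
          - complex_of_real (1 / (2 * s)) * z\<^sup>2
          + complex_of_real (sqrt (1 - s\<^sup>2) / s) * complex_of_real t * z + of_real ((1 + s\<^sup>2) / (4 * s)) * z\<^sup>2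
      = - of_real (t\<^sup>2 / (2 * s)) + of_real (kap * t / s) * z - of_real (bet / 2) * z\<^sup>2"
    unfolding b by (simp add: kap_def left_diff_distrib)
  then show ?thesis
    by (simp only: B_kernel_def gauss_factor_def gker_def B_const_def mult.assoc exp_add[symmetric])
qed

text \<open>Since z^2 + cnj z^2 is twice the real part of z^2, the non-radial half of the exponent
  is exactly the squared modulus of \<open>gauss_factor\<close>.\<close>

lemma omega_eq: "omega s z = (cmod (gauss_factor z))\<^sup>2 * exp (- bet * (cmod z)\<^sup>2)"
proof -
  have "(cmod (gauss_factor z))\<^sup>2 = exp (2 * Re (of_real ((1 + s\<^sup>2) / (4 * s)) * z\<^sup>2))"
    unfolding gauss_factor_def norm_exp_eq_Re exp_double ..
  also have "2 * Re (of_real ((1 + s\<^sup>2) / (4 * s)) * z\<^sup>2) = (1 + s\<^sup>2) / (4 * s) * Re (z\<^sup>2 + (cnj z)\<^sup>2)"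
    using s_pos by (simp add: Re_power2 field_simps)
  finally show ?thesis
    by (simp add: omega_def bet_def exp_add[symmetric] del: times_divide_eq_left)
qed

lemma B_kernel_integrable:
  assumes "f \<in> L2 lebesgue"
  shows "integrable lebesgue (\<lambda>t. B_kernel s t z * f t)"
proof -
  have "B_kernel s t z * f t = of_real B_const / gauss_factor z * (gker t z * f t)" for t
    using B_kernel_eq[of t z] by (simp add: field_simps)
  then show ?thesis
    using L2_mult_integrable[OF gker_L2[of z] assms] by simp
qed

lemma B_transform_sums:
  assumes "f \<in> L2 lebesgue"
  shows "(\<lambda>n. of_real B_const * L2_inner lebesgue f (\<lambda>t. of_real (herm n t)) * z ^ n)
    sums (B_transform s f z * gauss_factor z)"
proof -
  have "B_transform s f z * gauss_factor z = (\<integral>t. of_real B_const * (gker t z * f t) \<partial>lebesgue)"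
    unfolding B_transform_def integral_mult_left_zero[symmetric]
    by (intro Bochner_Integration.integral_cong refl) (simp add: B_kernel_eq mult.assoc[symmetric] mult.commute[of _ "gauss_factor z"] flip: B_kernel_eq)
  also have "\<dots> = of_real B_const * (\<integral>t. gker t z * f t \<partial>lebesgue)"
    by simp
  finally show ?thesis
    using sums_mult[OF gker_transform_sums[OF assms, of z], of "of_real B_const"]
    by (simp add: L2_inner_def mult_ac)
qed

text \<open>The weight at index n is the squared norm pi n! / bet^(n+1) of z^n, rewritten through
  \<open>hnorm\<close>. It applies to transforms and to given elements of \<open>X_space\<close>
  alike.\<close>

lemma nn_integral_omega_powser:
  assumes F: "F \<in> borel_measurable borel"
    and a: "\<And>z. (\<lambda>n. a n * z ^ n) sums (F z * gauss_factor z)"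
  shows "(\<integral>\<^sup>+z. ennreal ((cmod (F z))\<^sup>2) \<partial>omega_measure s)
    = (\<Sum>n. ennreal ((cmod (a n))\<^sup>2 / (B_const\<^sup>2 * hnorm n)))"
proof -
  have "(\<lambda>z. ennreal (omega s z)) \<in> borel_measurable borel"
    unfolding omega_def
    by (intro measurable_compose[OF _ measurable_ennreal] borel_measurable_continuous_onI continuous_intros)
  then have "(\<integral>\<^sup>+z. ennreal ((cmod (F z))\<^sup>2) \<partial>omega_measure s)
      = (\<integral>\<^sup>+z. ennreal (omega s z) * ennreal ((cmod (F z))\<^sup>2) \<partial>lebesgue)"
    unfolding omega_measure_def using F
    by (intro nn_integral_density lebesgue_measurableI) auto
  also have "\<dots> = (\<integral>\<^sup>+z. ennreal (omega s z) * ennreal ((cmod (F z))\<^sup>2) \<partial>lborel)"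
    by (rule nn_integral_completion)
  also have "\<dots> = (\<integral>\<^sup>+z. ennreal ((cmod (F z * gauss_factor z))\<^sup>2) * ennreal (exp (- bet * (cmod z)\<^sup>2)) \<partial>lborel)"
    by (intro nn_integral_cong)
      (simp add: omega_eq norm_mult power_mult_distrib ennreal_mult[symmetric] mult_ac)
  also have "\<dots> = (\<Sum>n. ennreal ((cmod (a n))\<^sup>2) * (\<integral>\<^sup>+z. ennreal ((cmod z) ^ (2 * n)) * ennreal (exp (- bet * (cmod z)\<^sup>2)) \<partial>lborel))"
    by (rule nn_integral_powser_radial[OF a]) measurable
  also have "\<dots> = (\<Sum>n. ennreal ((cmod (a n))\<^sup>2 / (B_const\<^sup>2 * hnorm n)))"
  proof (rule suminf_cong)
    fix n
    have "B_const\<^sup>2 * hnorm n = bet ^ Suc n / (pi * fact n)"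
      using s_pos by (simp add: B_const_sq hnorm_def)
    then show "ennreal ((cmod (a n))\<^sup>2) * (\<integral>\<^sup>+z. ennreal ((cmod z) ^ (2 * n)) * ennreal (exp (- bet * (cmod z)\<^sup>2)) \<partial>lborel)
        = ennreal ((cmod (a n))\<^sup>2 / (B_const\<^sup>2 * hnorm n))"
      unfolding nn_integral_gaussian_moment[OF bet_pos] using bet_pos by (simp flip: ennreal_mult)
  qed
  finally show ?thesis .
qed

lemma B_transform_holomorphic:
  assumes "f \<in> L2 lebesgue"
  shows "B_transform s f holomorphic_on UNIV"
proof -
  have "(\<lambda>z. (B_transform s f z * gauss_factor z) / gauss_factor z) holomorphic_on UNIV"
    by (intro holomorphic_on_divide powser_holomorphic[OF B_transform_sums[OF assms]] gauss_factor_holomorphic) simp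
  then show ?thesis
    by simp
qed

lemma entire_omega_measurable:
  "F holomorphic_on UNIV \<Longrightarrow> F \<in> borel_measurable (omega_measure s)"
  using lebesgue_measurableI[OF entire_borel_measurable] by (simp add: omega_measure_def)

section \<open>Isometry, injectivity and surjectivity\<close>

text \<open>The Taylor coefficients on the Fock side are \<open>B_const\<close> times the Hermite
  coefficients of \<open>f\<close>. After cancelling \<open>B_const\<close> the sum is the Parseval
  series of \<open>f\<close>, which gives membership in L2 and the norm together.\<close>

lemma B_transform_nn_integral:
  assumes f: "f \<in> L2 lebesgue"
  shows "(\<integral>\<^sup>+z. ennreal ((cmod (B_transform s f z))\<^sup>2) \<partial>omega_measure s) = ennreal (\<integral>t. (cmod (f t))\<^sup>2 \<partial>lebesgue)"
proof -
  have "(\<integral>\<^sup>+z. ennreal ((cmod (B_transform s f z))\<^sup>2) \<partial>omega_measure s)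
     = (\<Sum>n. ennreal ((cmod (of_real B_const * L2_inner lebesgue f (\<lambda>t. of_real (herm n t))))\<^sup>2 / (B_const\<^sup>2 * hnorm n)))"
    by (rule nn_integral_omega_powser[OF entire_borel_measurable[OF B_transform_holomorphic[OF f]] B_transform_sums[OF f]])
  also have "\<dots> = (\<Sum>n. ennreal ((cmod (L2_inner lebesgue f (\<lambda>t. of_real (herm n t))))\<^sup>2 / hnorm n))"
    using B_const_pos by (simp add: norm_mult power_mult_distrib)
  also have "\<dots> = ennreal (\<integral>t. (cmod (f t))\<^sup>2 \<partial>lebesgue)"
    by (intro suminf_ennreal_eq hermite.Parseval herm_total f divide_nonneg_pos zero_le_power2 hnorm_pos)
  finally show ?thesis .
qed

lemma B_transform_L2:
  assumes "f \<in> L2 lebesgue"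
  shows "B_transform s f \<in> L2 (omega_measure s)"
  using entire_omega_measurable[OF B_transform_holomorphic[OF assms]]
  by (simp add: L2_iff_nn_integral B_transform_nn_integral[OF assms])

lemma B_transform_isometry:
  assumes "f \<in> L2 lebesgue"
  shows "(\<integral>z. (cmod (B_transform s f z))\<^sup>2 \<partial>omega_measure s) = (\<integral>t. (cmod (f t))\<^sup>2 \<partial>lebesgue)"
  using B_transform_nn_integral[OF assms] by (simp add: L2_nn_integral[OF B_transform_L2[OF assms]])

lemma B_transform_lincomb:
  assumes "f \<in> L2 lebesgue" "g \<in> L2 lebesgue"
  shows "B_transform s (\<lambda>t. a * f t + b * g t) = (\<lambda>z. a * B_transform s f z + b * B_transform s g z)"
proof
  fix z
  have "B_kernel s t z * (a * f t + b * g t) = a * (B_kernel s t z * f t) + b * (B_kernel s t z * g t)" for t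
    by (simp add: algebra_simps)
  then show "B_transform s (\<lambda>t. a * f t + b * g t) z = a * B_transform s f z + b * B_transform s g z"
    using B_kernel_integrable[OF assms(1), of z] B_kernel_integrable[OF assms(2), of z]
    by (simp add: B_transform_def)
qed

lemma B_transform_inner:
  assumes "f \<in> L2 lebesgue" "g \<in> L2 lebesgue"
  shows "L2_inner (omega_measure s) (B_transform s f) (B_transform s g) = L2_inner lebesgue f g"
proof (rule L2_inner_eqI_isometry)
  fix a b
  show "(\<integral>z. (cmod (a * B_transform s f z + b * B_transform s g z))\<^sup>2 \<partial>omega_measure s)
      = (\<integral>t. (cmod (a * f t + b * g t))\<^sup>2 \<partial>lebesgue)"
    using B_transform_isometry[OF L2_lincomb[OF assms, of a b]] by (simp add: B_transform_lincomb[OF assms])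
qed (intro assms B_transform_L2)+

text \<open>The left side is equality at every z: the kernel integral ignores null sets, and
  conversely the isometry sends a zero transform back to an almost everywhere zero
  difference.\<close>

lemma B_transform_eq_iff:
  assumes "f \<in> L2 lebesgue" "g \<in> L2 lebesgue"
  shows "B_transform s f = B_transform s g \<longleftrightarrow> (AE t in lebesgue. f t = g t)"
proof
  assume eq: "B_transform s f = B_transform s g"
  have d: "(\<lambda>t. f t - g t) \<in> L2 lebesgue"
    by (rule L2_diff[OF assms])
  have "B_transform s (\<lambda>t. f t - g t) = (\<lambda>z. 0)"
    using B_transform_lincomb[OF assms, of 1 "-1"] eq by simp
  with B_transform_isometry[OF d] have "(\<integral>t. (cmod (f t - g t))\<^sup>2 \<partial>lebesgue) = 0"
    by simp
  then have "AE t in lebesgue. (cmod (f t - g t))\<^sup>2 = 0"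
    using integral_nonneg_eq_0_iff_AE[OF L2_integrable[OF d]] by simp
  then show "AE t in lebesgue. f t = g t"
    by simp
next
  assume ae: "AE t in lebesgue. f t = g t"
  show "B_transform s f = B_transform s g"
  proof
    fix z
    show "B_transform s f z = B_transform s g z"
      unfolding B_transform_def using ae
      by (intro integral_cong_AE borel_measurable_integrable B_kernel_integrable assms) auto
  qed
qed

text \<open>The Taylor coefficients of \<open>F * gauss_factor\<close> prescribe the Hermite
  coefficients of a preimage, and finiteness of the norm of \<open>F\<close> is the summability that
  Riesz-Fischer asks for. Equal power series and a nowhere zero \<open>gauss_factor\<close> then
  give equality at every point.\<close>

lemma B_transform_surj:
  assumes F: "F \<in> X_space s"
  obtains g where "g \<in> L2 lebesgue" "B_transform s g = F"
proof -
  have hol: "F holomorphic_on UNIV" and FL2: "F \<in> L2 (omega_measure s)"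
    using F by (auto simp: X_space_def)
  define a where "a n = (deriv ^^ n) (\<lambda>z. F z * gauss_factor z) 0 / fact n" for n
  have a: "(\<lambda>n. a n * z ^ n) sums (F z * gauss_factor z)" for z
    unfolding a_def by (intro entire_powser holomorphic_on_mult hol gauss_factor_holomorphic)
  have "(\<Sum>n. ennreal ((cmod (a n))\<^sup>2 / (B_const\<^sup>2 * hnorm n))) < \<infinity>"
    using FL2 nn_integral_omega_powser[OF entire_borel_measurable[OF hol] a] by (simp add: L2_iff_nn_integral)
  then have sm: "summable (\<lambda>n. (cmod (a n))\<^sup>2 / (B_const\<^sup>2 * hnorm n))"
    by (intro summable_suminf_not_top divide_nonneg_nonneg mult_nonneg_nonneg zero_le_power2
        less_imp_le[OF hnorm_pos]) auto
  \<comment> \<open>The expansion coefficient in the unnormalised system: the inner product with the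
    n-th Hermite function will be \<open>b n * hnorm n\<close>, and \<open>B_const\<close> times
    this has to be \<open>a n\<close>.\<close>
  define b where "b n = a n / of_real (B_const * hnorm n)" for n
  have "(cmod (b n))\<^sup>2 * hnorm n = (cmod (a n))\<^sup>2 / (B_const\<^sup>2 * hnorm n)" for n
    using hnorm_pos[of n] B_const_pos
    by (simp add: b_def norm_divide norm_mult power_divide power_mult_distrib power2_eq_square)
  with sm have "summable (\<lambda>n. (cmod (b n))\<^sup>2 * hnorm n)"
    by simp
  then obtain g where g: "g \<in> L2 lebesgue"
    "\<And>n. L2_inner lebesgue g (\<lambda>t. of_real (herm n t)) = b n * of_real (hnorm n)"
    using hermite.Riesz_Fischer by blast
  have ab: "of_real B_const * L2_inner lebesgue g (\<lambda>t. of_real (herm n t)) = a n" for n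
    using hnorm_pos[of n] B_const_pos by (simp add: g(2) b_def)
  have "B_transform s g z = F z" for z
    using sums_unique2[OF B_transform_sums[OF g(1), of z, unfolded ab] a[of z]] by simp
  with g(1) show ?thesis
    by (intro that) auto
qed

lemma B_transform_image: "B_transform s ` L2 lebesgue = X_space s"
  by (auto simp: X_space_def B_transform_holomorphic B_transform_L2 image_iff intro: B_transform_surj)

end

theorem theorem2p4:
  fixes s :: real
  assumes "0 < s" and "s < 1"
  shows "(\<forall>f \<in> L2 lebesgue. \<forall>z. integrable lebesgue (\<lambda>t. B_kernel s t z * f t))
    \<and> (\<forall>f \<in> L2 lebesgue. \<forall>g \<in> L2 lebesgue.
          B_transform s f = B_transform s g \<longleftrightarrow> (AE t in lebesgue. f t = g t))
    \<and> (\<forall>f \<in> L2 lebesgue. \<forall>g \<in> L2 lebesgue. \<forall>a b :: complex.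
          B_transform s (\<lambda>t. a * f t + b * g t)
            = (\<lambda>z. a * B_transform s f z + b * B_transform s g z))
    \<and> (\<forall>f \<in> L2 lebesgue. \<forall>g \<in> L2 lebesgue.
          L2_inner (omega_measure s) (B_transform s f) (B_transform s g) = L2_inner lebesgue f g)
    \<and> (\<forall>f \<in> L2 lebesgue.
          L2_norm (omega_measure s) (B_transform s f) = L2_norm lebesgue f)
    \<and> B_transform s ` L2 lebesgue = X_space s"
proof -
  interpret bargmann s
    using assms by unfold_locales
  show ?thesis
    by (intro conjI ballI allI B_kernel_integrable B_transform_eq_iff B_transform_lincomb
        B_transform_inner B_transform_image)
      (simp_all add: L2_norm_def B_transform_isometry)
qed

end
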